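(* Let $\kappa>0$, let $N\ge1$, $M\ge0$, let $\kappa_I\in\{\kappa,16/\kappa\}$ for $I=1,\dots,N$ and $h_{y_1},\dots,h_{y_M}\in\mathbb{R}$. Put $h_{x_I}=\frac{6-\kappa_I}{2\kappa_I}$. Let $\mathcal{L}_n$ be the operators on $\mathcal{F}$ defined in the context with parameters $\delta_{x_I}=h_{x_I}$ for all $I$, $\delta_{y_K}=h_{y_K}$ for all $K$, and $c=c(\kappa)=\frac{(6-\kappa)(3\kappa-8)}{2\kappa}$. Then for every $n\in\mathbb{Z}$ and every $I=1,\dots,N$ $$[\mathcal{L}_n,\mathcal{A}_I]=q_n(x_I;f_{-2},f_{-3},\dots)\,\mathcal{A}_I,$$ where $q_n$ is a homogeneous polynomial of degree $-n$ (with $x_I$ of degree $1$ and $f_m$ of degree $-m$), non-zero only for $n\le0$. In particular, if $\eta\in\mathrm{Ker}\,\mathcal{A}_I$ then $\mathcal{L}_n\eta\in\mathrm{Ker}\,\mathcal{A}_I$.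
   Context: Function space. Let $S\subset\mathbb{R}^{N+M}$ be the open set of points $(x_1,\dots,x_N,y_1,\dots,y_M)$ with pairwise distinct coordinates that are ordered on the real line in one fixed prescribed order. $\mathcal{F}=C^\infty(S\to\mathbb{C})[f_{-2},f_{-3},\dots]$ is the algebra of polynomials in the indeterminates $f_{-2},f_{-3},\dots$ with coefficients smooth complex functions on $S$. Formal series. $f(z)=z+\sum_{m\le -2}f_m z^{1+m}$, regarded as a formal Laurent series at $z=\infty$ with coefficients in $\mathbb{C}[f_{-2},f_{-3},\dots]$; $f',f'',f'''$ are formal derivatives, $Sf=\frac{f'''}{f'}-\frac32\left(\frac{f''}{f'}\right)^2$, and quotients and negative powers are expanded in $z^{-1}$. $\mathrm{Res}_z\sum_m a_mz^m=a_{-1}$. For $j\ge 0$, $$\Big(\frac{1}{(f(z)-r)^{1+j}}\Big)_{|f(z)|>|r|}=\sum_{m\ge 0}\binom{m}{j}f(z)^{-1-m}r^{m-j},$$ where $r$ may be a variable or another series such as $f(u)$. Operators. For $n\in\mathbb{Z}$, $\mathcal{L}_n:\mathcal{F}\to\mathcal{F}$ is $$\mathcal{L}_n=\mathrm{Res}_u\,u^{1-n}\Big\{\frac{c}{12}Sf(u)-\sum_{l\le-2}\mathrm{Res}_z\,f'(u)^2z^{-2-l}\Big(\frac{1}{f(z)-f(u)}\Big)_{|f(z)|>|f(u)|}\frac{\partial}{\partial f_l}$$ $$+\sum_{I=1}^N f'(u)^2\Big(\delta_{x_I}\Big(\frac{1}{(f(u)-x_I)^2}\Big)_{|f(u)|>|x_I|}+\Big(\frac{1}{f(u)-x_I}\Big)_{|f(u)|>|x_I|}\frac{\partial}{\partial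 x_I}\Big)$$ $$+\sum_{K=1}^M f'(u)^2\Big(\delta_{y_K}\Big(\frac{1}{(f(u)-y_K)^2}\Big)_{|f(u)|>|y_K|}+\Big(\frac{1}{f(u)-y_K}\Big)_{|f(u)|>|y_K|}\frac{\partial}{\partial y_K}\Big)\Big\}$$ (all coefficients are polynomials acting by multiplication after the derivative). For $I=1,\dots,N$, $\mathcal{A}_I:\mathcal{F}\to\mathcal{F}$ is $$\mathcal{A}_I=\mathcal{D}_I+2\sum_{m\le-2}p_m(-x_I,f_{-2},f_{-3},\dots)\frac{\partial}{\partial f_m},\qquad p_m(-x_I,f_{-2},\dots)=\mathrm{Res}_v\,v^{-2-m}\Big(\frac{1}{f(v)-x_I}\Big)_{|f(v)|>|x_I|},$$ $$\mathcal{D}_I=\frac{\kappa_I}{2}\frac{\partial^2}{\partial x_I^2}+\sum_{J\ne I}\Big(\frac{2}{x_J-x_I}\frac{\partial}{\partial x_J}+\frac{(\kappa_J-6)/\kappa_J}{(x_J-x_I)^2}\Big)+\sum_{K=1}^M\Big(\frac{2}{y_K-x_I}\frac{\partial}{\partial y_K}-\frac{2h_{y_K}}{(y_K-x_I)^2}\Big).$$ *)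

theory Defs
  imports
    "HOL-Analysis.Analysis"
    "HOL-Library.Poly_Mapping"
    "HOL-Computational_Algebra.Formal_Laurent_Series"
begin

(* fps_nth and vec_nth are both written with a dollar sign *)
unbundle no Formal_Power_Series.fps_syntax

section \<open>Smooth functions on the chamber\<close>

text \<open>
  The coordinates \<open>x\<^sub>1, \<dots>, x\<^sub>N, y\<^sub>1, \<dots>, y\<^sub>M\<close> are indexed by the elements of one finite linearly
  ordered type \<open>'k\<close>; the prescribed order of the points on the real line is the order of \<open>'k\<close>.
  Which indices belong to \<open>x\<close>-coordinates is recorded by a set \<open>X\<close> of indices, so that
  \<open>N = card X\<close> and \<open>M = card (- X)\<close>. Every \<open>N \<ge> 1\<close>, every \<open>M \<ge> 0\<close> and every prescribed order
  arise from some \<open>'k\<close> and some nonempty \<open>X\<close>.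
\<close>

definition chamber :: "(real ^ 'k::{finite,linorder}) set" where
  "chamber = {x. \<forall>i j. i < j \<longrightarrow> x $ i < x $ j}"

definition partial_at :: "'k \<Rightarrow> (real ^ 'k::finite \<Rightarrow> complex) \<Rightarrow> real ^ 'k \<Rightarrow> complex" where
  "partial_at i g x = frechet_derivative g (at x) (axis i 1)"

primrec Ck_on :: "nat \<Rightarrow> (real ^ 'k::finite) set \<Rightarrow> (real ^ 'k \<Rightarrow> complex) \<Rightarrow> bool" where
  "Ck_on 0 S g \<longleftrightarrow> continuous_on S g"
| "Ck_on (Suc n) S g \<longleftrightarrow> (\<forall>x\<in>S. g differentiable (at x)) \<and> (\<forall>i. Ck_on n S (partial_at i g))"

definition smooth_on :: "(real ^ 'k::finite) set \<Rightarrow> (real ^ 'k \<Rightarrow> complex) \<Rightarrow> bool" where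
  "smooth_on S g \<longleftrightarrow> (\<forall>n. Ck_on n S g)"

lemma open_chamber: "open (chamber :: (real ^ 'k::{finite,linorder}) set)"
proof -
  have "chamber = (\<Inter>i\<in>UNIV. \<Inter>j\<in>{j. i < j}. {x :: (real, 'k) vec. x $ i < x $ j})"
    by (auto simp: chamber_def)
  moreover have "open (\<Inter>i\<in>UNIV. \<Inter>j\<in>{j. i < j}. {x :: (real, 'k) vec. x $ i < x $ j})"
    by (intro open_INT ballI finite open_Collect_less continuous_intros)
  ultimately show ?thesis by simp
qed

lemma chamber_nonempty: "(chamber :: (real ^ 'k::{finite,linorder}) set) \<noteq> {}"
proof -
  have "(\<chi> i. real (card {j. j < i})) \<in> (chamber :: (real, 'k) vec set)"
    unfolding chamber_def by (auto intro!: psubset_card_mono)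
  then show ?thesis by blast
qed

lemma Ck_on_cong:
  assumes "open S" "\<And>x. x \<in> S \<Longrightarrow> f x = g x" "Ck_on n S f"
  shows "Ck_on n S g"
  using assms(2,3)
proof (induction n arbitrary: f g)
  case 0
  then show ?case using continuous_on_cong[of S S f g] by simp
next
  case (Suc n)
  have d: "(g has_derivative frechet_derivative f (at x)) (at x)" if "x \<in> S" for x
  proof (rule has_derivative_transform_within_open[OF _ assms(1) that])
    show "(f has_derivative frechet_derivative f (at x)) (at x)"
      using Suc.prems(2) that by (simp add: frechet_derivative_works)
  qed (use Suc.prems(1) in auto)
  have "partial_at i f x = partial_at i g x" if "x \<in> S" for i x
    unfolding partial_at_def using frechet_derivative_at[OF d[OF that]] by simp
  then have "Ck_on n S (partial_at i g)" for i
    using Suc.IH[of "partial_at i f" "partial_at i g"] Suc.prems(2) by auto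
  then show ?case using d by (auto simp: differentiable_def)
qed

lemma Ck_on_SucI:
  assumes "open S" and d: "\<And>x. x \<in> S \<Longrightarrow> (g has_derivative D x) (at x)"
    and c: "\<And>i. Ck_on n S (\<lambda>x. D x (axis i 1))"
  shows "Ck_on (Suc n) S g"
proof -
  have "Ck_on n S (partial_at i g)" for i
  proof (rule Ck_on_cong[OF assms(1) _ c])
    show "D x (axis i 1) = partial_at i g x" if "x \<in> S" for x
      unfolding partial_at_def using frechet_derivative_at[OF d[OF that]] by simp
  qed
  then show ?thesis using d by (auto simp: differentiable_def)
qed

lemma Ck_on_SucD:
  assumes "Ck_on (Suc n) S g"
  shows "x \<in> S \<Longrightarrow> (g has_derivative frechet_derivative g (at x)) (at x)"
    and "Ck_on n S (\<lambda>x. frechet_derivative g (at x) (axis i 1))"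
  using assms by (auto simp: frechet_derivative_works partial_at_def[abs_def])

lemma Ck_on_Suc: "Ck_on (Suc n) S g \<Longrightarrow> Ck_on n S g"
proof (induction n arbitrary: g)
  case 0
  then show ?case
    by (auto intro!: continuous_at_imp_continuous_on differentiable_imp_continuous_within)
next
  case (Suc n)
  then show ?case by (metis Ck_on.simps(2))
qed

lemma Ck_on_const: "open S \<Longrightarrow> Ck_on n S (\<lambda>_. c)"
proof (induction n arbitrary: c)
  case (Suc n)
  then show ?case by (intro Ck_on_SucI[where D = "\<lambda>_ _. 0"]) auto
qed simp

lemma Ck_on_add: "open S \<Longrightarrow> Ck_on n S f \<Longrightarrow> Ck_on n S g \<Longrightarrow> Ck_on n S (\<lambda>x. f x + g x)"
proof (induction n arbitrary: f g)
  case 0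
  then show ?case by (auto intro: continuous_intros)
next
  case (Suc n)
  note d = Ck_on_SucD(2)
  show ?case
    by (rule Ck_on_SucI[OF Suc.prems(1) has_derivative_add[OF Ck_on_SucD(1) Ck_on_SucD(1)]])
       (use Suc.prems Suc.IH[OF Suc.prems(1) d[OF Suc.prems(2)] d[OF Suc.prems(3)]]
        in \<open>simp_all del: Ck_on.simps\<close>)
qed

lemma Ck_on_mult: "open S \<Longrightarrow> Ck_on n S f \<Longrightarrow> Ck_on n S g \<Longrightarrow> Ck_on n S (\<lambda>x. f x * g x)"
proof (induction n arbitrary: f g)
  case 0
  then show ?case by (auto intro: continuous_intros)
next
  case (Suc n)
  note d = Ck_on_SucD(2)
  show ?case
    by (rule Ck_on_SucI[OF Suc.prems(1) has_derivative_mult[OF Ck_on_SucD(1) Ck_on_SucD(1)]])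
       (use Suc.prems Ck_on_add[OF Suc.prems(1)
          Suc.IH[OF Suc.prems(1) Ck_on_Suc[OF Suc.prems(2)] d[OF Suc.prems(3)]]
          Suc.IH[OF Suc.prems(1) d[OF Suc.prems(2)] Ck_on_Suc[OF Suc.prems(3)]]]
        in \<open>simp_all del: Ck_on.simps\<close>)
qed

lemma Ck_on_uminus: "open S \<Longrightarrow> Ck_on n S f \<Longrightarrow> Ck_on n S (\<lambda>x. - f x)"
  using Ck_on_mult[of S n "\<lambda>_. -1" f] Ck_on_const[of S n "-1"] by simp

lemma Ck_on_coord: "open S \<Longrightarrow> Ck_on n S (\<lambda>x. complex_of_real (x $ i))"
proof (induction n)
  case 0
  then show ?case by (auto intro!: continuous_intros)
next
  case (Suc n)
  have "((\<lambda>x. complex_of_real (x $ i)) has_derivative (\<lambda>h. complex_of_real (h $ i))) (at x)" for x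
    by (intro bounded_linear_imp_has_derivative bounded_linear_compose[OF bounded_linear_of_real]
        bounded_linear_vec_nth)
  then show ?case
    by (rule Ck_on_SucI[OF Suc.prems]) (use Suc.prems in \<open>auto intro: Ck_on_const\<close>)
qed

lemma Ck_on_inverse:
  "open S \<Longrightarrow> Ck_on n S f \<Longrightarrow> (\<And>x. x \<in> S \<Longrightarrow> f x \<noteq> 0) \<Longrightarrow> Ck_on n S (\<lambda>x. inverse (f x))"
proof (induction n)
  case 0
  then show ?case by (auto intro!: continuous_on_inverse)
next
  case (Suc n)
  have i: "Ck_on n S (\<lambda>x. inverse (f x))"
    using Suc Ck_on_Suc by blast
  show ?case
    by (rule Ck_on_SucI[OF Suc.prems(1) Deriv.has_derivative_inverse[OF _ Ck_on_SucD(1)]])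
       (use Suc.prems Ck_on_uminus[OF Suc.prems(1) Ck_on_mult[OF Suc.prems(1)
          Ck_on_mult[OF Suc.prems(1) i Ck_on_SucD(2)[OF Suc.prems(2)]] i]]
        in \<open>simp_all del: Ck_on.simps\<close>)
qed

text \<open>
  The ring of smooth complex functions on the chamber. A function on the chamber is represented by
  its extension by \<open>0\<close> to the whole space, so that equality in the type is equality on the chamber.
\<close>

typedef (overloaded) ('k::"{finite,linorder}") smooth_fun =
  "{g :: (real, 'k) vec \<Rightarrow> complex. smooth_on chamber g \<and> (\<forall>x. x \<notin> chamber \<longrightarrow> g x = 0)}"
  morphisms sf_apply Abs_smooth_fun
  by (rule exI[of _ "\<lambda>_. 0"]) (simp add: smooth_on_def Ck_on_const open_chamber)

setup_lifting type_definition_smooth_fun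

lemma smooth_on_zero_ext:
  assumes "smooth_on chamber (g :: real ^ 'k::{finite,linorder} \<Rightarrow> complex)"
  shows "smooth_on chamber (\<lambda>x. if x \<in> chamber then g x else 0)"
  using assms unfolding smooth_on_def by (auto intro: Ck_on_cong[OF open_chamber, of g])

lift_definition sf_const :: "complex \<Rightarrow> 'k::{finite,linorder} smooth_fun" is
  "\<lambda>c x. if x \<in> chamber then c else 0"
  by (auto intro!: smooth_on_zero_ext) (simp add: smooth_on_def Ck_on_const open_chamber)

lift_definition sf_coord :: "'k \<Rightarrow> 'k::{finite,linorder} smooth_fun" is
  "\<lambda>i x. if x \<in> chamber then complex_of_real (x $ i) else 0"
  by (auto intro!: smooth_on_zero_ext) (simp add: smooth_on_def Ck_on_coord open_chamber)

lift_definition sf_partial :: "'k \<Rightarrow> 'k smooth_fun \<Rightarrow> 'k::{finite,linorder} smooth_fun" is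
  "\<lambda>i g x. if x \<in> chamber then partial_at i g x else 0"
  by (auto intro!: smooth_on_zero_ext) (metis Ck_on.simps(2) smooth_on_def)

text \<open>The function \<open>1 / (x\<^sub>j - x\<^sub>i)\<close>, used only for \<open>j \<noteq> i\<close>.\<close>

lift_definition sf_inv_diff :: "'k \<Rightarrow> 'k \<Rightarrow> 'k::{finite,linorder} smooth_fun" is
  "\<lambda>j i x. if x \<in> chamber then complex_of_real (1 / (x $ j - x $ i)) else 0"
proof (intro conjI smooth_on_zero_ext)
  fix i j :: 'k
  show "smooth_on chamber (\<lambda>x :: (real, 'k) vec. complex_of_real (1 / (x $ j - x $ i)))"
  proof (cases "i = j")
    case True
    then show ?thesis by (simp add: smooth_on_def Ck_on_const open_chamber)
  next
    case False
    then have ne: "complex_of_real (x $ j) + - complex_of_real (x $ i) \<noteq> 0"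
      if "x \<in> chamber" for x :: "(real, 'k) vec"
      using that unfolding chamber_def by (metis (mono_tags, lifting) add_uminus_conv_diff
        eq_iff_diff_eq_0 less_irrefl mem_Collect_eq neqE of_real_eq_iff)
    have "Ck_on n chamber
        (\<lambda>x :: (real, 'k) vec. inverse (complex_of_real (x $ j) + - complex_of_real (x $ i)))" for n
      using ne by (intro Ck_on_inverse Ck_on_add Ck_on_uminus Ck_on_coord open_chamber) auto
    then show ?thesis
      by (simp add: smooth_on_def inverse_eq_divide)
  qed
qed auto

instantiation smooth_fun :: ("{finite,linorder}") comm_ring_1
begin

lift_definition zero_smooth_fun :: "'a smooth_fun" is "\<lambda>_. 0"
  by (simp add: smooth_on_def Ck_on_const open_chamber)

lift_definition one_smooth_fun :: "'a smooth_fun" is "\<lambda>x. if x \<in> chamber then 1 else 0"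
  by (auto intro!: smooth_on_zero_ext) (simp add: smooth_on_def Ck_on_const open_chamber)

lift_definition plus_smooth_fun :: "'a smooth_fun \<Rightarrow> 'a smooth_fun \<Rightarrow> 'a smooth_fun" is
  "\<lambda>f g x. f x + g x"
  by (simp add: smooth_on_def Ck_on_add open_chamber)

lift_definition times_smooth_fun :: "'a smooth_fun \<Rightarrow> 'a smooth_fun \<Rightarrow> 'a smooth_fun" is
  "\<lambda>f g x. f x * g x"
  by (simp add: smooth_on_def Ck_on_mult open_chamber)

lift_definition uminus_smooth_fun :: "'a smooth_fun \<Rightarrow> 'a smooth_fun" is "\<lambda>f x. - f x"
  by (simp add: smooth_on_def Ck_on_uminus open_chamber)

definition minus_smooth_fun :: "'a smooth_fun \<Rightarrow> 'a smooth_fun \<Rightarrow> 'a smooth_fun" where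
  "minus_smooth_fun f g = f + - g"

instance
proof
  fix a b c :: "'a smooth_fun"
  show "a + b + c = a + (b + c)" by transfer (simp add: add.assoc)
  show "a + b = b + a" by transfer (simp add: add.commute)
  show "0 + a = a" by transfer simp
  show "- a + a = 0" by transfer simp
  show "a - b = a + - b" by (rule minus_smooth_fun_def)
  show "a * b * c = a * (b * c)" by transfer (simp add: mult.assoc)
  show "a * b = b * a" by transfer (simp add: mult.commute)
  show "1 * a = a" by transfer auto
  show "(a + b) * c = a * c + b * c" by transfer (simp add: distrib_right)
  obtain x :: "(real, 'a) vec" where "x \<in> chamber"
    using chamber_nonempty by blast
  then have "sf_apply (0 :: 'a smooth_fun) x \<noteq> sf_apply 1 x"
    by (simp add: zero_smooth_fun.rep_eq one_smooth_fun.rep_eq)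
  then show "(0 :: 'a smooth_fun) \<noteq> 1" by auto
qed

end


section \<open>The algebra \<open>\<F>\<close>\<close>

text \<open>
  Polynomials over a ring \<open>'a\<close> in indeterminates \<open>'v\<close> are the finitely supported maps from
  monomials \<open>'v \<Rightarrow>\<^sub>0 nat\<close> to \<open>'a\<close>. In \<open>\<F>\<close> the indeterminates are numbered by natural numbers:
  \<^emph>\<open>the number \<open>k\<close> stands for the indeterminate \<open>f\<^sub>m\<close> with \<open>m = - 2 - k\<close>\<close>.
\<close>

type_synonym ('v, 'a) mvpoly = "('v \<Rightarrow>\<^sub>0 nat) \<Rightarrow>\<^sub>0 'a"

type_synonym 'k alg = "(nat, 'k smooth_fun) mvpoly"

definition coeff_fun :: "'k smooth_fun \<Rightarrow> 'k::{finite,linorder} alg" where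
  "coeff_fun g = Poly_Mapping.single 0 g"

definition scalar :: "complex \<Rightarrow> 'k::{finite,linorder} alg" where
  "scalar a = coeff_fun (sf_const a)"

abbreviation rscalar :: "real \<Rightarrow> 'k::{finite,linorder} alg" where
  "rscalar a \<equiv> scalar (complex_of_real a)"

definition coord :: "'k \<Rightarrow> 'k::{finite,linorder} alg" where
  "coord i = coeff_fun (sf_coord i)"

definition inv_diff :: "'k \<Rightarrow> 'k \<Rightarrow> 'k::{finite,linorder} alg" where
  "inv_diff j i = coeff_fun (sf_inv_diff j i)"

definition fvar :: "nat \<Rightarrow> 'k::{finite,linorder} alg" where
  "fvar k = Poly_Mapping.single (Poly_Mapping.single k 1) 1"

definition d_coord :: "'k \<Rightarrow> 'k alg \<Rightarrow> 'k::{finite,linorder} alg" where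
  "d_coord i \<eta> = Poly_Mapping.map (sf_partial i) \<eta>"

text \<open>
  \<open>\<partial>/\<partial>f\<^sub>m\<close> with \<open>m = - 2 - k\<close>. The subtraction of exponents is truncated, but a monomial without the
  indeterminate \<open>k\<close> gets the coefficient \<open>0\<close>.
\<close>

definition d_fvar :: "nat \<Rightarrow> 'k alg \<Rightarrow> 'k::{finite,linorder} alg" where
  "d_fvar k \<eta> = (\<Sum>\<mu>\<in>Poly_Mapping.keys \<eta>.
     Poly_Mapping.single (\<mu> - Poly_Mapping.single k 1)
       (of_nat (Poly_Mapping.lookup \<mu> k) * Poly_Mapping.lookup \<eta> \<mu>))"


section \<open>Formal Laurent series at infinity\<close>

text \<open>
  A formal Laurent series at \<open>z = \<infinity>\<close> is an element of the type \<open>'a fls\<close> in the variable \<open>1/z\<close>: the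
  coefficient of \<open>z\<^sup>m\<close> in \<open>g\<close> is \<open>fls_nth g (- m)\<close>. Series in two variables whose coefficients of
  powers of \<open>z\<close> are series in \<open>u\<close> are elements of \<open>'a fls fls\<close>, with \<open>u\<close> the inner variable.
\<close>

definition zpow :: "int \<Rightarrow> 'a::comm_ring_1 fls" where
  "zpow m = fls_X_intpow (- m)"

definition Res :: "'a::comm_ring_1 fls \<Rightarrow> 'a" where
  "Res g = fls_nth g 1"

text \<open>\<open>d/dz = - z\<^sup>-\<^sup>2 d/d(1/z)\<close>.\<close>

definition dz :: "'a::comm_ring_1 fls \<Rightarrow> 'a fls" where
  "dz g = - (zpow (- 2) * fls_deriv g)"

text \<open>
  \<open>f(z) = z + \<Sum>\<^bsub>m \<le> -2\<^esub> f\<^sub>m z\<^bsup>1+m\<^esup> = z + \<Sum>\<^bsub>k \<ge> 0\<^esub> \<phi>\<^sub>k z\<^bsup>-1-k\<^esup>\<close>, where \<open>\<phi>\<^sub>k = f\<^bsub>-2-k\<^esub>\<close>.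
\<close>

definition fseries :: "(nat \<Rightarrow> 'a::comm_ring_1) \<Rightarrow> 'a fls" where
  "fseries \<phi> = zpow 1 + fps_to_fls (Abs_fps (\<lambda>n. if n = 0 then 0 else \<phi> (n - 1)))"

text \<open>Inverse of a series whose leading coefficient is \<open>1\<close>.\<close>

definition monic_inv :: "'a::comm_ring_1 fls \<Rightarrow> 'a fls" where
  "monic_inv g = fls_right_inverse g 1"

text \<open>
  The expansion of \<open>1 / (g(z) - r)\<^bsup>1+j\<^esup>\<close> in \<open>\<bar>g(z)\<bar> > \<bar>r\<bar>\<close>, that is,
  \<open>\<Sum>\<^bsub>m \<ge> 0\<^esub> (m choose j) g(z)\<^bsup>-1-m\<^esup> r\<^bsup>m-j\<^esup>\<close>, for a series \<open>g(z) = z + \<dots>\<close>. Since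
  \<open>g(z)\<^bsup>-1-m\<^esup> = z\<^bsup>-1-m\<^esup> + \<dots>\<close>, exactly the terms with \<open>m < n\<close> can contribute to the coefficient
  of \<open>z\<^bsup>-n\<^esup>\<close>, and no nonnegative power of \<open>z\<close> occurs.
\<close>

definition expansion :: "nat \<Rightarrow> 'a::comm_ring_1 fls \<Rightarrow> 'a \<Rightarrow> 'a fls" where
  "expansion j g r = fps_to_fls (Abs_fps (\<lambda>n.
     \<Sum>m<n. of_nat (m choose j) * fls_nth (monic_inv g ^ (1 + m)) (int n) * r ^ (m - j)))"


section \<open>The operators\<close>

definition schwarzian :: "'k::{finite,linorder} alg fls \<Rightarrow> 'k alg fls" where
  "schwarzian g = dz (dz (dz g)) * monic_inv (dz g)
     - fls_const (rscalar (3 / 2)) * (dz (dz g) * monic_inv (dz g))\<^sup>2"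

definition f_ser :: "'k::{finite,linorder} alg fls" where
  "f_ser = fseries fvar"

text \<open>\<open>f(z)\<close> as a series in \<open>z\<close> over the ring of series in \<open>u\<close>.\<close>

definition f_ser_outer :: "'k::{finite,linorder} alg fls fls" where
  "f_ser_outer = fseries (\<lambda>k. fls_const (fvar k))"

text \<open>
  The operator \<open>\<L>\<^sub>n\<close>. The weights \<open>\<delta>\<close> of the \<open>x\<close>- and the \<open>y\<close>-coordinates enter in the same way, so
  the sums over \<open>I\<close> and over \<open>K\<close> are one sum over all coordinates. With \<open>l = - 2 - k\<close> one has
  \<open>z\<^bsup>-2-l\<^esup> = z\<^sup>k\<close>, and only finitely many \<open>l\<close> satisfy \<open>\<partial>\<eta>/\<partial>f\<^sub>l \<noteq> 0\<close>.
\<close>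

definition L_op ::
  "real \<Rightarrow> ('k \<Rightarrow> real) \<Rightarrow> int \<Rightarrow> 'k alg \<Rightarrow> 'k::{finite,linorder} alg" where
  "L_op c \<delta> n \<eta> = Res (zpow (1 - n) * (
       fls_const (rscalar (c / 12)) * schwarzian f_ser * fls_const \<eta>
     - (\<Sum>k | d_fvar k \<eta> \<noteq> 0.
          Res (fls_const ((dz f_ser)\<^sup>2) * zpow (int k) * expansion 0 f_ser_outer f_ser)
          * fls_const (d_fvar k \<eta>))
     + (\<Sum>i\<in>UNIV. (dz f_ser)\<^sup>2 *
          (fls_const (rscalar (\<delta> i)) * expansion 1 f_ser (coord i) * fls_const \<eta>
           + expansion 0 f_ser (coord i) * fls_const (d_coord i \<eta>)))))"

definition D_op ::
  "'k set \<Rightarrow> ('k \<Rightarrow> real) \<Rightarrow> ('k \<Rightarrow> real) \<Rightarrow> 'k \<Rightarrow> 'k alg \<Rightarrow> 'k::{finite,linorder} alg" where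
  "D_op X \<kappa> h i \<eta> =
     rscalar (\<kappa> i / 2) * d_coord i (d_coord i \<eta>)
     + (\<Sum>j\<in>X - {i}. 2 * inv_diff j i * d_coord j \<eta>
                        + rscalar ((\<kappa> j - 6) / \<kappa> j) * (inv_diff j i)\<^sup>2 * \<eta>)
     + (\<Sum>j\<in>- X. 2 * inv_diff j i * d_coord j \<eta>
                    - rscalar (2 * h j) * (inv_diff j i)\<^sup>2 * \<eta>)"

text \<open>\<open>p\<^sub>m(- x\<^sub>i, f\<^bsub>-2\<^esub>, f\<^bsub>-3\<^esub>, \<dots>)\<close> with \<open>m = - 2 - k\<close>.\<close>

definition p_coeff :: "nat \<Rightarrow> 'k \<Rightarrow> 'k::{finite,linorder} alg" where
  "p_coeff k i = Res (zpow (int k) * expansion 0 f_ser (coord i))"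

definition A_op ::
  "'k set \<Rightarrow> ('k \<Rightarrow> real) \<Rightarrow> ('k \<Rightarrow> real) \<Rightarrow> 'k \<Rightarrow> 'k alg \<Rightarrow> 'k::{finite,linorder} alg" where
  "A_op X \<kappa> h i \<eta> =
     D_op X \<kappa> h i \<eta> + 2 * (\<Sum>k | d_fvar k \<eta> \<noteq> 0. p_coeff k i * d_fvar k \<eta>)"


section \<open>Polynomials in one coordinate and the \<open>f\<^sub>m\<close>\<close>

text \<open>As before, \<open>F_var k\<close> stands for \<open>f\<^sub>m\<close> with \<open>m = - 2 - k\<close>; its degree is \<open>- m = k + 2\<close>.\<close>

datatype qvar = X_var | F_var nat

primrec qvar_degree :: "qvar \<Rightarrow> int" where
  "qvar_degree X_var = 1"
| "qvar_degree (F_var k) = int k + 2"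

definition homogeneous :: "int \<Rightarrow> (qvar, complex) mvpoly \<Rightarrow> bool" where
  "homogeneous d q \<longleftrightarrow> (\<forall>\<mu>\<in>Poly_Mapping.keys q.
     (\<Sum>v\<in>Poly_Mapping.keys \<mu>. int (Poly_Mapping.lookup \<mu> v) * qvar_degree v) = d)"

primrec qvar_value :: "'k \<Rightarrow> qvar \<Rightarrow> 'k::{finite,linorder} alg" where
  "qvar_value i X_var = coord i"
| "qvar_value i (F_var k) = fvar k"

text \<open>The element \<open>q(x\<^sub>i; f\<^bsub>-2\<^esub>, f\<^bsub>-3\<^esub>, \<dots>)\<close> of \<open>\<F>\<close>.\<close>

definition q_value :: "(qvar, complex) mvpoly \<Rightarrow> 'k \<Rightarrow> 'k::{finite,linorder} alg" where
  "q_value q i = (\<Sum>\<mu>\<in>Poly_Mapping.keys q.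
     scalar (Poly_Mapping.lookup q \<mu>)
     * (\<Prod>v\<in>Poly_Mapping.keys \<mu>. qvar_value i v ^ Poly_Mapping.lookup \<mu> v))"

end

(*
  Everything takes place in the ring of series in u over F. The vector field in the f_m that is
  determined by f(z) -> 1/(f(z) - x_I) enters A_I, and the one with f(z) -> 1/(f(z) - f(u)) enters
  the generating series of the L_n. The resolvent identity for 1/(f(z) - x_I) and
  1/(f(z) - f(u)) gives their bracket. The rest of the commutator is a computation with
  derivations of the poles g_J = 1/(f(u) - x_J), g = g_I: the terms with J <> I cancel by the
  partial fraction relation for 1/(f(u) - x_I), 1/(f(u) - x_J) and 1/(x_J - x_I), the terms of order
  g^3 by kappa_I (2 h + 1) = 6, and those of order g^4, to which the Schwarzian derivative
  contributes - 6 f'^2 g^4, by c = (3 kappa_I - 8) h, where h = h_{x_I}. What remains is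
  [L(u), A_I] = - 2 f'(u)^2 / (f(u) - x_I)^2 A_I, so that q_n is a coefficient of this series.
*)

theory Submission
  imports Defs
begin

text \<open>The coefficient ring has zero divisors, so a pole cannot be handled as a quotient. Every
  expansion is used through an equation such as (f - x) g = 1, which already determines how a
  derivation acts on g, and the final cancellation is exhibited as an explicit multiple of such a
  relation. The factor - 2 f'(u)^2 g^2 can be read off from the second-order part: d g/dx_I = g^2,
  so commuting f'(u)^2 g d/dx_I past (\<kappa>_I / 2) d^2/dx_I^2 gives exactly this multiple of the
  latter, up to lower order. One c serves all x_I because (3 t - 8) (6 - t) / (2 t) is invariant
  under t -> 16/t. Since (\<kappa>_J - 6) / \<kappa>_J = - 2 h_{x_J}, the points x_J with J \<noteq>
  I enter A_I in the same form as the points y_K, and the proof treats both kinds at once. Mixed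
  partial derivatives have to commute; this is derived here from symmetric second
  differences.\<close>

section \<open>Partial derivatives of smooth functions\<close>

text \<open>Mean value inequality in direction i for s -> g(x + s a + t b) - g(x + s a) - s t D b.
  The derivative of this function is an increment of \<open>partial_at i g\<close> minus t D b,
  which is small because \<open>partial_at i g\<close> is differentiable at x. The second difference
  is symmetric in i and j, so the bound can be used with both orders of differentiation.\<close>

lemma second_difference_bound:
  fixes g :: "real ^ 'k::finite \<Rightarrow> complex"
  assumes S: "open S" "x \<in> S"
    and g: "\<And>y. y \<in> S \<Longrightarrow> g differentiable (at y)"
    and gi: "partial_at i g differentiable (at x)"
    and \<epsilon>: "\<epsilon> > 0"
  shows "\<exists>\<delta>>0. \<forall>t. 0 < t \<and> t < \<delta> \<longrightarrow>
    norm (g (x + t *\<^sub>R axis i 1 + t *\<^sub>R axis j 1) - g (x + t *\<^sub>R axis i 1) - g (x + t *\<^sub>R axis j 1) + g x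
      - of_real (t\<^sup>2) * partial_at j (partial_at i g) x) \<le> \<epsilon> * t\<^sup>2"
proof -
  define D where "D = frechet_derivative (partial_at i g) (at x)"
  define a b :: "real ^ 'k" where "a = axis i 1" and "b = axis j 1"
  have ab: "norm a = 1" "norm b = 1" by (simp_all add: a_def b_def)
  have D: "(partial_at i g has_derivative D) (at x)"
    using gi by (simp add: D_def frechet_derivative_works)
  interpret D: linear D using D by (rule has_derivative_linear)
  have Db: "partial_at j (partial_at i g) x = D b" by (simp add: partial_at_def D_def b_def)
  \<comment> \<open>The share \<epsilon>/3 is chosen because increments of length at most 2 t and at
    most t will be compared, with total error \<epsilon> t.\<close>
  have "\<exists>d>0. \<forall>y. norm (y - x) < d \<longrightarrow>
      norm (partial_at i g y - partial_at i g x - D (y - x)) \<le> \<epsilon> / 3 * norm (y - x)"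
    using D \<epsilon> unfolding has_derivative_at_alt by (metis divide_pos_pos zero_less_numeral)
  then obtain d where d: "d > 0" and dD: "\<And>y. norm (y - x) < d \<Longrightarrow>
      norm (partial_at i g y - partial_at i g x - D (y - x)) \<le> \<epsilon> / 3 * norm (y - x)"
    by blast
  obtain e where e: "e > 0" "ball x e \<subseteq> S" using S open_contains_ball by blast
  \<comment> \<open>Half of the radius, as the points x + s a + t b may be at distance up to 2 t
    from x.\<close>
  define \<delta> where "\<delta> = min d e / 2"
  have "norm (g (x + t *\<^sub>R a + t *\<^sub>R b) - g (x + t *\<^sub>R a) - g (x + t *\<^sub>R b) + g x
      - of_real (t\<^sup>2) * D b) \<le> \<epsilon> * t\<^sup>2" if t: "0 < t" "t < \<delta>" for t
  proof -
    have tb: "norm (s *\<^sub>R a + t *\<^sub>R b) \<le> 2 * t" "norm (s *\<^sub>R a) \<le> t" if "s \<in> {0..t}" for s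
      using that t norm_triangle_ineq[of "s *\<^sub>R a" "t *\<^sub>R b"] ab by auto
    have S1: "x + s *\<^sub>R a + t *\<^sub>R b \<in> S" "x + s *\<^sub>R a \<in> S" if "s \<in> {0..t}" for s
    proof -
      have "dist x (x + s *\<^sub>R a + t *\<^sub>R b) < e" "dist x (x + s *\<^sub>R a) < e"
        using tb[OF that] t unfolding dist_commute[of x] \<delta>_def by (simp_all add: dist_norm add.assoc)
      then show "x + s *\<^sub>R a + t *\<^sub>R b \<in> S" "x + s *\<^sub>R a \<in> S" using e(2) by auto
    qed
    define \<phi> where "\<phi> s = g (x + s *\<^sub>R a + t *\<^sub>R b) - g (x + s *\<^sub>R a) - of_real (s * t) * D b" for s
    have line: "((\<lambda>s. g (x + s *\<^sub>R a + v)) has_vector_derivative partial_at i g (x + s *\<^sub>R a + v))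
        (at s within T)" if "x + s *\<^sub>R a + v \<in> S" for s v T
    proof -
      have G: "(g has_derivative frechet_derivative g (at (x + s *\<^sub>R a + v))) (at (x + s *\<^sub>R a + v))"
        using g[OF that] by (simp add: frechet_derivative_works)
      interpret G: linear "frechet_derivative g (at (x + s *\<^sub>R a + v))"
        using G by (rule has_derivative_linear)
      have "((\<lambda>s. x + s *\<^sub>R a + v) has_derivative (\<lambda>h. h *\<^sub>R a)) (at s within T)"
        by (auto intro!: derivative_eq_intros)
      from has_derivative_compose[OF this G] show ?thesis
        by (simp add: has_vector_derivative_def G.scale partial_at_def flip: a_def)
    qed
    have \<phi>': "(\<phi> has_vector_derivative
        (partial_at i g (x + s *\<^sub>R a + t *\<^sub>R b) - partial_at i g (x + s *\<^sub>R a) - of_real t * D b))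
        (at s within {0..t})" if "s \<in> {0..t}" for s
    proof -
      have "((\<lambda>s. of_real (s * t) * D b) has_vector_derivative of_real t * D b) (at s within {0..t})"
        unfolding scaleR_conv_of_real[symmetric] by (auto intro!: derivative_eq_intros)
      with line[of s "t *\<^sub>R b"] line[of s 0] S1[OF that] show ?thesis
        unfolding \<phi>_def by (intro has_vector_derivative_diff) simp_all
    qed
    have bd: "norm (partial_at i g (x + s *\<^sub>R a + t *\<^sub>R b) - partial_at i g (x + s *\<^sub>R a) - of_real t * D b)
        \<le> \<epsilon> * t" if s: "s \<in> {0..t}" for s
    proof -
      let ?y = "x + s *\<^sub>R a + t *\<^sub>R b" and ?z = "x + s *\<^sub>R a"
      have yz: "?y - x = s *\<^sub>R a + t *\<^sub>R b" "?z - x = s *\<^sub>R a" by simp_all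
      have "norm (?y - x) < d" "norm (?z - x) < d"
        using tb[OF s] t unfolding yz \<delta>_def by linarith+
      note this[THEN dD]
      moreover have "\<epsilon> / 3 * norm (?y - x) \<le> \<epsilon> / 3 * (2 * t)" "\<epsilon> / 3 * norm (?z - x) \<le> \<epsilon> / 3 * t"
        unfolding yz using tb[OF s] \<epsilon> by (intro mult_left_mono; simp)+
      moreover have "partial_at i g ?y - partial_at i g ?z - of_real t * D b =
          (partial_at i g ?y - partial_at i g x - D (?y - x)) - (partial_at i g ?z - partial_at i g x - D (?z - x))"
        unfolding yz D.add D.scale by (simp add: scaleR_conv_of_real[of t "D b"])
      ultimately show ?thesis
        using norm_triangle_ineq4[of "partial_at i g ?y - partial_at i g x - D (?y - x)"
            "partial_at i g ?z - partial_at i g x - D (?z - x)"]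
        by (simp add: field_simps)
    qed
    have "norm (\<phi> t - \<phi> 0) \<le> \<epsilon> * t * norm (t - 0)"
    proof (rule differentiable_bound[OF _ \<phi>'[unfolded has_vector_derivative_def] onorm_le])
      show "norm (h *\<^sub>R (partial_at i g (x + s *\<^sub>R a + t *\<^sub>R b) - partial_at i g (x + s *\<^sub>R a)
          - of_real t * D b)) \<le> \<epsilon> * t * norm h" if "s \<in> {0..t}" for s h
        using mult_left_mono[OF bd[OF that], of "\<bar>h\<bar>"] by (simp add: mult_ac)
    qed (use t in auto)
    then show ?thesis using t by (simp add: \<phi>_def power2_eq_square algebra_simps)
  qed
  moreover have "\<delta> > 0" using d e by (simp add: \<delta>_def)
  ultimately show ?thesis unfolding Db a_def b_def by blast
qed

text \<open>Both mixed derivatives, multiplied by t^2, approximate the same second difference within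
  \<epsilon> t^2. With \<epsilon> a third of their distance this is contradictory.\<close>

lemma partial_at_commute:
  fixes g :: "real ^ 'k::finite \<Rightarrow> complex"
  assumes S: "open S" "x \<in> S"
    and g: "\<And>y. y \<in> S \<Longrightarrow> g differentiable (at y)"
    and d: "partial_at i g differentiable (at x)" "partial_at j g differentiable (at x)"
  shows "partial_at i (partial_at j g) x = partial_at j (partial_at i g) x"
proof (rule ccontr)
  let ?I = "partial_at j (partial_at i g) x" and ?J = "partial_at i (partial_at j g) x"
  assume ne: "?J \<noteq> ?I"
  define \<epsilon> where "\<epsilon> = norm (?J - ?I) / 3"
  have \<epsilon>: "\<epsilon> > 0" using ne by (simp add: \<epsilon>_def)
  let ?\<Delta> = "\<lambda>t. g (x + t *\<^sub>R axis i 1 + t *\<^sub>R axis j 1) - g (x + t *\<^sub>R axis i 1) - g (x + t *\<^sub>R axis j 1) + g x"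
  obtain \<delta>1 where 1: "\<delta>1 > 0"
    "\<And>t. 0 < t \<Longrightarrow> t < \<delta>1 \<Longrightarrow> norm (?\<Delta> t - of_real (t\<^sup>2) * ?I) \<le> \<epsilon> * t\<^sup>2"
    using second_difference_bound[OF S g d(1) \<epsilon>, of j] by blast
  obtain \<delta>2 where 2: "\<delta>2 > 0"
    "\<And>t. 0 < t \<Longrightarrow> t < \<delta>2 \<Longrightarrow> norm (?\<Delta> t - of_real (t\<^sup>2) * ?J) \<le> \<epsilon> * t\<^sup>2"
    using second_difference_bound[OF S g d(2) \<epsilon>, of i] by (auto simp: algebra_simps)
  define t where "t = min \<delta>1 \<delta>2 / 2"
  have t: "0 < t" "t < \<delta>1" "t < \<delta>2" using 1 2 by (auto simp: t_def)
  have "of_real (t\<^sup>2) * (?J - ?I) = (?\<Delta> t - of_real (t\<^sup>2) * ?I) - (?\<Delta> t - of_real (t\<^sup>2) * ?J)"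
    by (simp add: algebra_simps)
  then have "norm (of_real (t\<^sup>2) * (?J - ?I)) \<le> \<epsilon> * t\<^sup>2 + \<epsilon> * t\<^sup>2"
    using norm_triangle_le_diff[OF add_mono[OF 1(2)[OF t(1,2)] 2(2)[OF t(1,3)]]] by simp
  then have "t\<^sup>2 * (3 * \<epsilon>) \<le> t\<^sup>2 * (2 * \<epsilon>)"
    by (simp add: norm_mult norm_power \<epsilon>_def)
  then show False using t \<epsilon> by simp
qed

lemma sf_apply_smooth:
  "smooth_on chamber (sf_apply (f :: 'k::{finite,linorder} smooth_fun))" "x \<notin> chamber \<Longrightarrow> sf_apply f x = 0"
  using sf_apply[of f] by auto

lemma smooth_on_differentiable:
  assumes "smooth_on S g" "x \<in> S"
  shows "g differentiable (at x)" "partial_at i g differentiable (at x)"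
proof -
  have "Ck_on (Suc (Suc 0)) S g" using assms(1) unfolding smooth_on_def by blast
  then show "g differentiable (at x)" "partial_at i g differentiable (at x)"
    using assms(2) unfolding Ck_on.simps(2) by blast+
qed

text \<open>\<open>sf_partial\<close> cuts off by 0 outside the chamber. As the chamber is open, the
  cut-off does not affect a further derivative at a point inside, and the commutation for
  \<open>partial_at\<close> applies.\<close>

lemma sf_partial_commute: "sf_partial i (sf_partial j f) = sf_partial j (sf_partial i f)"
proof -
  have "partial_at i (sf_apply (sf_partial j f)) x = partial_at i (partial_at j (sf_apply f)) x"
    if x: "x \<in> chamber" for i j x
  proof -
    have "(sf_apply (sf_partial j f) has_derivative
        frechet_derivative (partial_at j (sf_apply f)) (at x)) (at x)"
    proof (rule has_derivative_transform_within_open[OF _ open_chamber x])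
      show "(partial_at j (sf_apply f) has_derivative
          frechet_derivative (partial_at j (sf_apply f)) (at x)) (at x)"
        using smooth_on_differentiable(2)[OF sf_apply_smooth(1) x] by (simp add: frechet_derivative_works)
    qed (simp add: sf_partial.rep_eq)
    from frechet_derivative_at[OF this] show ?thesis by (simp add: partial_at_def)
  qed
  note eq = this
  have "partial_at i (sf_apply (sf_partial j f)) x = partial_at j (sf_apply (sf_partial i f)) x"
    if x: "x \<in> chamber" for x
    unfolding eq[OF x]
    by (rule partial_at_commute[OF open_chamber x]; rule smooth_on_differentiable[OF sf_apply_smooth(1)])
      (assumption | rule x)+
  then have "sf_apply (sf_partial i (sf_partial j f)) = sf_apply (sf_partial j (sf_partial i f))"
    unfolding sf_partial.rep_eq[of _ "sf_partial _ _"] by fastforce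
  then show ?thesis by (simp add: sf_apply_inject)
qed

section \<open>Leibniz rule and values of the derivations \<open>sf_partial\<close>\<close>

lemma partial_at_eqI:
  assumes "(g has_derivative D) (at x)"
  shows "partial_at i g x = D (axis i 1)"
  using frechet_derivative_at[OF assms] by (simp add: partial_at_def)

lemma sf_has_derivative:
  "x \<in> chamber \<Longrightarrow> (sf_apply f has_derivative frechet_derivative (sf_apply f) (at x)) (at x)"
  using smooth_on_differentiable(1)[OF sf_apply_smooth(1)] by (simp add: frechet_derivative_works)

lemma sf_partial_add: "sf_partial i (f + g) = sf_partial i f + sf_partial i g"
proof (intro sf_apply_inject[THEN iffD1] ext)
  fix x
  show "sf_apply (sf_partial i (f + g)) x = sf_apply (sf_partial i f + sf_partial i g) x"
  proof (cases "x \<in> chamber")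
    case True
    from partial_at_eqI[OF has_derivative_add[OF sf_has_derivative[OF this] sf_has_derivative[OF this]],
        of i f g]
    show ?thesis using True
      by (simp add: sf_partial.rep_eq plus_smooth_fun.rep_eq partial_at_def)
  qed (simp add: sf_apply_smooth)
qed

lemma sf_partial_mult: "sf_partial i (f * g) = f * sf_partial i g + sf_partial i f * g"
proof (intro sf_apply_inject[THEN iffD1] ext)
  fix x
  show "sf_apply (sf_partial i (f * g)) x = sf_apply (f * sf_partial i g + sf_partial i f * g) x"
  proof (cases "x \<in> chamber")
    case True
    from partial_at_eqI[OF has_derivative_mult[OF sf_has_derivative[OF this] sf_has_derivative[OF this]],
        of i f g]
    show ?thesis using True
      by (simp add: sf_partial.rep_eq plus_smooth_fun.rep_eq times_smooth_fun.rep_eq partial_at_def)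
  qed (simp add: sf_apply_smooth)
qed

lemma sf_partial_const: "sf_partial i (sf_const a) = 0"
proof (intro sf_apply_inject[THEN iffD1] ext)
  fix x
  have "partial_at i (sf_apply (sf_const a)) x = 0" if "x \<in> chamber"
    by (rule partial_at_eqI[OF has_derivative_transform_within_open[OF has_derivative_const open_chamber that]])
      (simp add: sf_const.rep_eq)
  then show "sf_apply (sf_partial i (sf_const a)) x = sf_apply 0 x"
    by (simp add: sf_partial.rep_eq zero_smooth_fun.rep_eq)
qed

lemma sf_partial_coord: "sf_partial i (sf_coord j) = (if i = j then 1 else 0)"
proof (intro sf_apply_inject[THEN iffD1] ext)
  fix x
  have "partial_at i (sf_apply (sf_coord j)) x = complex_of_real (axis i 1 $ j)" if "x \<in> chamber"
  proof (rule partial_at_eqI[OF has_derivative_transform_within_open[OF _ open_chamber that]])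
    show "((\<lambda>x. complex_of_real (x $ j)) has_derivative (\<lambda>h. complex_of_real (h $ j))) (at x)"
      by (intro bounded_linear_imp_has_derivative bounded_linear_compose[OF bounded_linear_of_real]
          bounded_linear_vec_nth)
  qed (simp add: sf_coord.rep_eq)
  then show "sf_apply (sf_partial i (sf_coord j)) x = sf_apply (if i = j then 1 else 0) x"
    by (auto simp: sf_partial.rep_eq zero_smooth_fun.rep_eq one_smooth_fun.rep_eq axis_def)
qed

lemma sf_const_add: "sf_const (a + b) = sf_const a + sf_const b"
  by transfer auto

lemma sf_const_mult: "sf_const (a * b) = sf_const a * sf_const b"
  by transfer auto

lemma sf_const_1: "sf_const 1 = 1"
  by transfer auto

lemma sf_inv_diff:
  assumes "j \<noteq> i"
  shows "sf_inv_diff j i * (sf_coord j - sf_coord i) = 1"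
proof -
  have "x $ j \<noteq> x $ i" if "x \<in> chamber" for x
    using assms that unfolding chamber_def neq_iff by blast
  then have "sf_apply (sf_inv_diff j i * (sf_coord j - sf_coord i)) x = sf_apply 1 x" for x
    by (cases "x \<in> chamber")
      (simp_all add: times_smooth_fun.rep_eq minus_smooth_fun_def plus_smooth_fun.rep_eq
        uminus_smooth_fun.rep_eq one_smooth_fun.rep_eq sf_inv_diff.rep_eq sf_coord.rep_eq
        del: add_uminus_conv_diff)
  then have "sf_apply (sf_inv_diff j i * (sf_coord j - sf_coord i)) = sf_apply 1" ..
  then show ?thesis by (simp add: sf_apply_inject)
qed

section \<open>Derivations and Laurent series\<close>

locale comm_ring_hom =
  fixes \<phi> :: "'a::comm_ring_1 \<Rightarrow> 'b::comm_ring_1"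
  assumes hom_add: "\<phi> (a + b) = \<phi> a + \<phi> b"
    and hom_mult: "\<phi> (a * b) = \<phi> a * \<phi> b"
    and hom_1: "\<phi> 1 = 1"
begin

lemma hom_0: "\<phi> 0 = 0"
  using hom_add[of 0 0] by simp

lemma hom_of_int: "\<phi> (of_int n) = of_int n"
proof -
  have nat: "\<phi> (of_nat k) = of_nat k" for k
    by (induction k) (simp_all add: hom_add hom_0 hom_1)
  have "\<phi> (of_int n) + \<phi> (of_nat (nat (- n))) = \<phi> (of_nat (nat n))"
    by (cases "n \<ge> 0") (simp_all flip: hom_add add: hom_0)
  then show ?thesis unfolding nat by (cases "n \<ge> 0") (simp_all add: eq_neg_iff_add_eq_0)
qed

end

text \<open>Derivations along a homomorphism are allowed because \<open>vf_series\<close> maps the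
  algebra into series over it, where the Leibniz rule has its coefficients embedded by
  \<open>fls_const\<close>.\<close>

locale hom_derivation = comm_ring_hom \<phi> for \<phi> :: "'a::comm_ring_1 \<Rightarrow> 'b::comm_ring_1" +
  fixes D :: "'a \<Rightarrow> 'b"
  assumes add: "D (a + b) = D a + D b"
    and mult: "D (a * b) = \<phi> a * D b + D a * \<phi> b"
begin

lemma zero [simp]: "D 0 = 0"
  using add[of 0 0] by simp

lemma one [simp]: "D 1 = 0"
  using mult[of 1 1] by (simp add: hom_1)

lemma uminus: "D (- a) = - D a"
  using add[of a "- a"] by (simp add: eq_neg_iff_add_eq_0 add.commute)

lemma diff: "D (a - b) = D a - D b"
  using add[of a "- b"] by (simp add: uminus)

lemma sum: "D (\<Sum>i\<in>I. f i) = (\<Sum>i\<in>I. D (f i))"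
  by (induction I rule: infinite_finite_induct) (simp_all add: add)

lemma of_nat [simp]: "D (of_nat n) = 0"
  by (induction n) (simp_all add: add)

lemma numeral [simp]: "D (numeral n) = 0"
  using of_nat[of "numeral n"] by simp

lemma of_int [simp]: "D (of_int n) = 0"
proof (cases "n \<ge> 0")
  case True
  then show ?thesis using of_nat[of "nat n"] by simp
next
  case False
  then show ?thesis using of_nat[of "nat (- n)"] by (simp add: uminus)
qed

lemma power2: "D (a\<^sup>2) = 2 * \<phi> a * D a"
  by (simp add: power2_eq_square mult)

text \<open>Apply D to a b = 1 and multiply by the image of b. Only the relation itself is used, so
  this serves every pole although the ring has no division.\<close>

lemma inverse:
  assumes "a * b = 1"
  shows "D b = - ((\<phi> b)\<^sup>2 * D a)"
proof -
  have ab: "\<phi> a * \<phi> b = 1" using hom_mult[of a b] unfolding assms hom_1 ..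
  have "0 = \<phi> b * D (a * b)" unfolding assms by simp
  also have "\<dots> = (\<phi> a * \<phi> b) * D b + (\<phi> b)\<^sup>2 * D a"
    by (simp add: mult algebra_simps power2_eq_square)
  finally show ?thesis unfolding ab by (simp add: eq_neg_iff_add_eq_0)
qed

end

section \<open>Coefficientwise maps of Laurent series\<close>

definition fls_map :: "('a::zero \<Rightarrow> 'b::zero) \<Rightarrow> 'a fls \<Rightarrow> 'b fls" where
  "fls_map h f = Abs_fls (\<lambda>n. h (fls_nth f n))"

text \<open>The condition \<open>h 0 = 0\<close> makes the image vanish below some exponent, so that
  \<open>Abs_fls\<close> keeps all its coefficients.\<close>

lemma fls_nth_map: "h 0 = 0 \<Longrightarrow> fls_nth (fls_map h f) n = h (fls_nth f n)"
  unfolding fls_map_def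
  by (rule nth_Abs_fls_ex_lower_bound) (metis fls_nth_vanishes_belowE)

lemma fls_map_ident [simp]: "fls_map (\<lambda>x. x) f = f"
  by (intro fls_eqI) (simp add: fls_nth_map)

lemma fls_map_const: "h 0 = 0 \<Longrightarrow> fls_map h (fls_const a) = fls_const (h a)"
  by (intro fls_eqI) (simp add: fls_nth_map)

lemma fls_map_compose:
  "g 0 = 0 \<Longrightarrow> h 0 = 0 \<Longrightarrow> fls_map g (fls_map h f) = fls_map (\<lambda>x. g (h x)) f"
  by (intro fls_eqI) (simp add: fls_nth_map)

text \<open>The subdegree may rise when a map is applied to the coefficients. With fixed lower
  bounds a and b, the products before and after are sums over the same indices and can be compared
  termwise.\<close>

lemma fls_times_nth_bounds:
  fixes f g :: "'a::comm_ring_1 fls"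
  assumes f: "\<And>i. i < a \<Longrightarrow> fls_nth f i = 0" and g: "\<And>i. i < b \<Longrightarrow> fls_nth g i = 0"
  shows "fls_nth (f * g) n = (\<Sum>i=a..n - b. fls_nth f i * fls_nth g (n - i))"
proof (cases "f = 0 \<or> g = 0")
  case False
  then have le: "a \<le> fls_subdegree f" "b \<le> fls_subdegree g"
    using f g by (simp_all add: fls_subdegree_geI)
  show ?thesis
    unfolding fls_times_nth(2)
    by (rule sum.mono_neutral_left) (use le in \<open>auto simp: not_le\<close>)
qed auto

context hom_derivation
begin

lemma fls_map_hom_derivation: "hom_derivation (fls_map \<phi>) (fls_map D)"
proof
  fix f g :: "'a fls"
  obtain a b where f: "\<And>i. i < a \<Longrightarrow> fls_nth f i = 0" and g: "\<And>i. i < b \<Longrightarrow> fls_nth g i = 0"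
    by (metis fls_nth_vanishes_belowE)
  have hom_sum: "\<phi> (\<Sum>i\<in>I. F i) = (\<Sum>i\<in>I. \<phi> (F i))" for I :: "int set" and F
    by (induction I rule: infinite_finite_induct) (simp_all add: hom_add hom_0)
  show "fls_map \<phi> (f + g) = fls_map \<phi> f + fls_map \<phi> g" "fls_map D (f + g) = fls_map D f + fls_map D g"
    by (intro fls_eqI; simp add: fls_nth_map hom_add hom_0 add)+
  show "fls_map \<phi> 1 = 1"
    using fls_map_const[of \<phi> 1] by (simp add: hom_0 hom_1)
  show "fls_map \<phi> (f * g) = fls_map \<phi> f * fls_map \<phi> g"
    using f g by (intro fls_eqI)
      (simp add: fls_nth_map hom_0 fls_times_nth_bounds[where a = a and b = b] hom_sum hom_mult)
  show "fls_map D (f * g) = fls_map \<phi> f * fls_map D g + fls_map D f * fls_map \<phi> g"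
    using f g by (intro fls_eqI)
      (simp add: fls_nth_map fls_times_nth_bounds[where a = a and b = b] hom_0 sum mult sum.distrib)
qed

end

lemma zpow_times_nth: "fls_nth (zpow m * f) n = fls_nth f (n + m)"
  unfolding zpow_def fls_X_intpow_times_conv_shift by simp

lemma Res_zpow: "Res (zpow m * f) = fls_nth f (1 + m)"
  by (simp add: Res_def zpow_times_nth)

lemma dz_nth: "fls_nth (dz f) n = of_int (1 - n) * fls_nth f (n - 1)"
  by (simp add: dz_def zpow_times_nth) (simp add: algebra_simps)

lemma dz_add: "dz (f + g) = dz f + dz g"
  by (intro fls_eqI) (simp add: dz_nth algebra_simps)

lemma dz_mult: "dz (f * g) = f * dz g + dz f * g"
  by (simp add: dz_def algebra_simps)

lemma dz_const [simp]: "dz (fls_const a) = 0"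
  by (simp add: dz_def)

lemma dz_hom_derivation: "hom_derivation (\<lambda>f. f) dz"
  by unfold_locales (simp_all add: dz_add dz_mult)

text \<open>The factors that \<open>dz\<close> introduces are integers: they are annihilated by D
  and preserved by the homomorphism.\<close>

lemma (in hom_derivation) fls_map_dz: "fls_map D (dz f) = dz (fls_map D f)"
proof (intro fls_eqI)
  show "fls_nth (fls_map D (dz f)) n = fls_nth (dz (fls_map D f)) n" for n
    using hom_of_int[of "1 - n"] of_int[of "1 - n"] by (simp only: fls_nth_map zero dz_nth mult) simp
qed

lemma fseries_nth: "fls_nth (fseries \<phi>) n = (if n = -1 then 1 else if n \<ge> 1 then \<phi> (nat n - 1) else 0)"
  by (auto simp: fseries_def zpow_def nat_diff_distrib)

lemma fls_map_fseries: "h 0 = 0 \<Longrightarrow> h 1 = 1 \<Longrightarrow> fls_map h (fseries \<phi>) = fseries (\<lambda>k. h (\<phi> k))"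
  by (intro fls_eqI) (simp add: fls_nth_map fseries_nth)

lemma monic_inv:
  assumes "fls_nth g d = 1" "\<And>n. n < d \<Longrightarrow> fls_nth g n = 0"
  shows "g * monic_inv g = 1"
proof -
  have "fls_subdegree g = d" using assms by (intro fls_subdegree_eqI) auto
  then show ?thesis unfolding monic_inv_def using assms(1) by (intro fls_right_inverse) simp
qed

lemma monic_inv_dz_fseries: "dz (fseries \<phi>) * monic_inv (dz (fseries \<phi>)) = 1"
  by (rule monic_inv[of _ 0]) (auto simp: dz_nth fseries_nth)

section \<open>The expansions as inverses\<close>

lemma fls_nth_power_eq_0:
  fixes h :: "'a::comm_ring_1 fls"
  assumes "\<And>i. i < 1 \<Longrightarrow> fls_nth h i = 0" "n < int m"
  shows "fls_nth (h ^ m) n = 0"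
  using assms(2)
proof (induction m arbitrary: n)
  case (Suc m)
  show ?case
    using Suc fls_times_nth_bounds[of 1 h "int m" "h ^ m" n] assms(1) by simp
qed simp

text \<open>This allows an infinite expansion to be replaced by a finite partial sum when one
  coefficient of a product is computed.\<close>

lemma fls_nth_mult_cong:
  fixes a y p :: "'a::comm_ring_1 fls"
  assumes "\<And>i. i < d \<Longrightarrow> fls_nth a i = 0" "\<And>i. i \<le> n - d \<Longrightarrow> fls_nth y i = fls_nth p i"
  shows "fls_nth (a * y) n = fls_nth (a * p) n"
proof -
  have "fls_nth (a * (y - p)) n = 0"
    using fls_times_nth_bounds[of d a "n - d + 1" "y - p" n] assms by simp
  then show ?thesis by (simp add: algebra_simps)
qed

lemma expansion_nth:
  "fls_nth (expansion j g r) n =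
     (\<Sum>m<nat n. of_nat (m choose j) * fls_nth (monic_inv g ^ (1 + m)) n * r ^ (m - j))"
  by (cases "n < 0") (simp_all add: expansion_def)

context
  fixes g :: "'a::comm_ring_1 fls" and r :: 'a
  assumes g1: "fls_nth g (- 1) = 1" and g0: "\<And>n. n < - 1 \<Longrightarrow> fls_nth g n = 0"
begin

lemma monic_inv_nth_eq_0: "n < int m \<Longrightarrow> fls_nth (monic_inv g ^ m) n = 0"
proof (rule fls_nth_power_eq_0)
  have "fls_subdegree g = - 1" using g1 g0 by (intro fls_subdegree_eqI) auto
  then have "fls_subdegree (monic_inv g) = 1"
    unfolding monic_inv_def by (subst fls_lr_inverse_subdegree(2)) simp_all
  then show "fls_nth (monic_inv g) i = 0" if "i < 1" for i using that by simp
qed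

lemma monic_inv_g: "g * monic_inv g = 1"
  using monic_inv g1 g0 by blast

lemma g_minus_const_nth: "i < - 1 \<Longrightarrow> fls_nth (g - fls_const r) i = 0"
  by (simp add: g0)

text \<open>The partial sums of the expansion, whose products with \<open>g - r\<close> telescope.\<close>

private definition psum :: "nat \<Rightarrow> nat \<Rightarrow> 'a fls" where
  "psum j M = (\<Sum>m<M. of_nat (m choose j) * monic_inv g ^ (1 + m) * fls_const (r ^ (m - j)))"

private lemma expansion_nth_psum:
  assumes "n \<le> int M"
  shows "fls_nth (expansion j g r) n = fls_nth (psum j M) n"
proof -
  have "fls_nth (psum j M) n =
      (\<Sum>m<M. of_nat (m choose j) * fls_nth (monic_inv g ^ (1 + m)) n * r ^ (m - j))"
    by (simp add: psum_def fls_nth_sum)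
  also have "\<dots> = (\<Sum>m<nat n. of_nat (m choose j) * fls_nth (monic_inv g ^ (1 + m)) n * r ^ (m - j))"
    using assms by (intro sum.mono_neutral_right)
      (auto simp: monic_inv_nth_eq_0 nat_less_iff simp del: power_Suc plus_1_eq_Suc)
  finally show ?thesis by (simp add: expansion_nth)
qed

private lemma telescope:
  "(g - fls_const r) * (monic_inv g ^ (1 + m) * fls_const (r ^ k))
     = monic_inv g ^ m * fls_const (r ^ k) - monic_inv g ^ (1 + m) * fls_const (r ^ (1 + k))"
proof -
  have "(g - fls_const r) * (monic_inv g ^ (1 + m) * fls_const (r ^ k)) =
      (g * monic_inv g) * (monic_inv g ^ m * fls_const (r ^ k))
      - monic_inv g ^ (1 + m) * (fls_const r * fls_const (r ^ k))"
    by (simp add: algebra_simps del: fls_const_mult_const)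
  then show ?thesis by (simp add: monic_inv_g)
qed

private lemma psum_0: "(g - fls_const r) * psum 0 M = 1 - monic_inv g ^ M * fls_const (r ^ M)"
  by (induction M) (use telescope in \<open>simp_all add: psum_def distrib_left\<close>)

text \<open>Summation by parts: the weights m choose 1 = m increase by one at each step, so the
  telescoped differences add up to the partial sum for j = 0, minus one boundary term.\<close>

private lemma psum_1:
  "(g - fls_const r) * psum 1 (Suc M) = psum 0 M - of_nat M * (monic_inv g ^ (1 + M) * fls_const (r ^ M))"
proof (induction M)
  case (Suc M)
  have "(g - fls_const r) * psum 1 (Suc (Suc M)) = (g - fls_const r) * psum 1 (Suc M)
      + of_nat (Suc M) * ((g - fls_const r) * (monic_inv g ^ (1 + Suc M) * fls_const (r ^ M)))"
    unfolding psum_def sum.lessThan_Suc[of _ "Suc M"] by (simp add: algebra_simps)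
  then show ?case
    unfolding Suc.IH telescope by (simp add: psum_def algebra_simps)
qed (simp add: psum_def)

lemma expansion_0: "(g - fls_const r) * expansion 0 g r = 1"
proof (rule fls_eqI)
  fix n
  \<comment> \<open>Since g - r starts at z, the coefficient n of the product involves coefficients
    of the expansion up to n + 1. The remainder after M terms has order at least M > n in 1/z and
    does not contribute.\<close>
  define M where "M = nat (n + 1)"
  have "fls_nth ((g - fls_const r) * expansion 0 g r) n = fls_nth ((g - fls_const r) * psum 0 M) n"
    by (rule fls_nth_mult_cong[OF g_minus_const_nth expansion_nth_psum]) (auto simp: M_def)
  also have "\<dots> = fls_nth 1 n"
    unfolding psum_0 by (simp add: monic_inv_nth_eq_0 M_def)
  finally show "fls_nth ((g - fls_const r) * expansion 0 g r) n = fls_nth 1 n" .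
qed

text \<open>Telescoping shows that multiplication by g - r turns the expansion for j = 1 into that
  for j = 0, which is itself the inverse of g - r.\<close>

lemma expansion_1: "expansion 1 g r = (expansion 0 g r)\<^sup>2"
proof -
  have "(g - fls_const r) * expansion 1 g r = expansion 0 g r"
  proof (rule fls_eqI)
    fix n
    define M where "M = nat (n + 1)"
    have "fls_nth ((g - fls_const r) * expansion 1 g r) n = fls_nth ((g - fls_const r) * psum 1 (Suc M)) n"
      by (rule fls_nth_mult_cong[OF g_minus_const_nth expansion_nth_psum]) (auto simp: M_def)
    also have "\<dots> = fls_nth (expansion 0 g r) n"
      unfolding psum_1 using monic_inv_nth_eq_0[of n "1 + M"]
      by (simp add: expansion_nth_psum[of n M] M_def)
    finally show "fls_nth ((g - fls_const r) * expansion 1 g r) n = fls_nth (expansion 0 g r) n" .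
  qed
  then have "(expansion 0 g r)\<^sup>2 = expansion 0 g r * ((g - fls_const r) * expansion 1 g r)"
    by (simp add: power2_eq_square)
  also have "\<dots> = ((g - fls_const r) * expansion 0 g r) * expansion 1 g r"
    by (simp only: mult_ac)
  finally show ?thesis by (simp add: expansion_0)
qed

end

lemma expansion_fseries_0: "(fseries \<phi> - fls_const r) * expansion 0 (fseries \<phi>) r = 1"
  by (rule expansion_0) (simp_all add: fseries_nth)

lemma expansion_fseries_1: "expansion 1 (fseries \<phi>) r = (expansion 0 (fseries \<phi>) r)\<^sup>2"
  by (rule expansion_1) (simp_all add: fseries_nth)

lemma expansion_nth_eq_0: "n \<le> 0 \<Longrightarrow> fls_nth (expansion j g r) n = 0"
  by (simp add: expansion_nth)

section \<open>Derivations of \<open>\<F>\<close>\<close>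

lemma sf_derivation: "hom_derivation (\<lambda>f. f) (sf_partial i)"
  by unfold_locales (simp_all add: sf_partial_add sf_partial_mult)

lemma sf_partial_0 [simp]: "sf_partial i 0 = 0" and sf_partial_1 [simp]: "sf_partial i 1 = 0"
  using hom_derivation.zero[OF sf_derivation] hom_derivation.one[OF sf_derivation] by blast+

lemma lookup_d_coord: "Poly_Mapping.lookup (d_coord i \<eta>) \<mu> = sf_partial i (Poly_Mapping.lookup \<eta> \<mu>)"
  by (simp add: d_coord_def map.rep_eq when_def)

text \<open>On monomials that contain the indeterminate k, the truncated subtraction is a true one
  and hence injective; the others carry the coefficient 0. So at most one summand of
  \<open>d_fvar\<close> reaches a given monomial.\<close>

lemma lookup_d_fvar:
  "Poly_Mapping.lookup (d_fvar k \<eta>) \<mu> = of_nat (Poly_Mapping.lookup \<mu> k + 1)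
     * Poly_Mapping.lookup \<eta> (\<mu> + Poly_Mapping.single k 1)"
proof -
  let ?s = "Poly_Mapping.single k (1 :: nat)"
  have eq: "Poly_Mapping.lookup (Poly_Mapping.single (\<nu> - ?s)
      (of_nat (Poly_Mapping.lookup \<nu> k) * Poly_Mapping.lookup \<eta> \<nu>)) \<mu>
    = (if \<nu> = \<mu> + ?s then of_nat (Poly_Mapping.lookup \<mu> k + 1) * Poly_Mapping.lookup \<eta> \<nu> else 0)" for \<nu>
  proof (cases "Poly_Mapping.lookup \<nu> k = 0")
    case True
    then have "\<nu> \<noteq> \<mu> + ?s" by (auto simp: lookup_add)
    then show ?thesis using True by simp
  next
    case False
    then have "\<nu> - ?s + ?s = \<nu>"
      by (intro poly_mapping_eqI) (auto simp: lookup_add lookup_minus lookup_single when_def)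
    then have "\<nu> - ?s = \<mu> \<longleftrightarrow> \<nu> = \<mu> + ?s" by auto
    then show ?thesis by (auto simp: lookup_single when_def lookup_add)
  qed
  show ?thesis
    unfolding d_fvar_def lookup_sum eq by (auto simp: in_keys_iff)
qed

lemma poly_mapping_single_induct:
  assumes "P 0" "\<And>p q. P p \<Longrightarrow> P q \<Longrightarrow> P (p + q)" "\<And>\<mu> a. P (Poly_Mapping.single \<mu> a)"
  shows "P (p :: 'a \<Rightarrow>\<^sub>0 'b::comm_monoid_add)"
proof -
  have "p = (\<Sum>\<mu>\<in>Poly_Mapping.keys p. Poly_Mapping.single \<mu> (Poly_Mapping.lookup p \<mu>))"
    by (intro poly_mapping_eqI) (auto simp: lookup_sum lookup_single when_def in_keys_iff)
  moreover have "P (\<Sum>\<mu>\<in>I. Poly_Mapping.single \<mu> (Poly_Mapping.lookup p \<mu>))" for I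
    by (induction I rule: infinite_finite_induct) (simp_all add: assms)
  ultimately show ?thesis by metis
qed

lemma derivation_if_single:
  fixes D :: "('v::cancel_comm_monoid_add \<Rightarrow>\<^sub>0 'a::comm_ring_1) \<Rightarrow> 'v \<Rightarrow>\<^sub>0 'a"
  assumes add: "\<And>p q. D (p + q) = D p + D q"
    and single: "\<And>\<mu> \<nu> a b. D (Poly_Mapping.single (\<mu> + \<nu>) (a * b))
      = Poly_Mapping.single \<mu> a * D (Poly_Mapping.single \<nu> b) + D (Poly_Mapping.single \<mu> a) * Poly_Mapping.single \<nu> b"
  shows "hom_derivation (\<lambda>p. p) D"
proof
  have D0: "D 0 = 0" using add[of 0 0] by simp
  have "D (p * Poly_Mapping.single \<nu> b) = p * D (Poly_Mapping.single \<nu> b) + D p * Poly_Mapping.single \<nu> b" for p \<nu> b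
    by (induction p rule: poly_mapping_single_induct)
      (simp_all add: D0 add mult_single single algebra_simps)
  then show "D (p * q) = p * D q + D p * q" for p q
    by (induction q rule: poly_mapping_single_induct) (simp_all add: D0 add algebra_simps)
qed (simp_all add: add)

interpretation d_coord: hom_derivation "\<lambda>\<eta>. \<eta>" "d_coord i"
proof (rule derivation_if_single)
  have "d_coord i (Poly_Mapping.single \<mu> a) = Poly_Mapping.single \<mu> (sf_partial i a)" for \<mu> a
    by (intro poly_mapping_eqI) (auto simp: lookup_d_coord lookup_single when_def)
  then show "d_coord i (Poly_Mapping.single (\<mu> + \<nu>) (a * b)) =
      Poly_Mapping.single \<mu> a * d_coord i (Poly_Mapping.single \<nu> b)
      + d_coord i (Poly_Mapping.single \<mu> a) * Poly_Mapping.single \<nu> b" for \<mu> \<nu> a b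
    by (simp add: mult_single sf_partial_mult flip: single_add)
qed (auto intro!: poly_mapping_eqI simp: lookup_d_coord lookup_add sf_partial_add)

interpretation d_fvar: hom_derivation "\<lambda>\<eta>. \<eta>" "d_fvar k"
proof (rule derivation_if_single)
  let ?s = "Poly_Mapping.single k (1 :: nat)"
  have d: "d_fvar k (Poly_Mapping.single \<mu> a)
      = Poly_Mapping.single (\<mu> - ?s) (of_nat (Poly_Mapping.lookup \<mu> k) * a)" for \<mu> and a :: "'a smooth_fun"
    by (cases "a = 0") (simp_all add: d_fvar_def)
  \<comment> \<open>If k does not occur in \<nu>, the monomials may differ because of truncation,
    but both coefficients are 0.\<close>
  have m: "Poly_Mapping.single (\<mu> + \<nu> - ?s) (of_nat (Poly_Mapping.lookup \<nu> k) * c)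
      = Poly_Mapping.single (\<mu> + (\<nu> - ?s)) (of_nat (Poly_Mapping.lookup \<nu> k) * c)" for \<mu> \<nu> and c :: "'a smooth_fun"
  proof (cases "Poly_Mapping.lookup \<nu> k = 0")
    case False
    then have "\<mu> + \<nu> - ?s = \<mu> + (\<nu> - ?s)"
      by (intro poly_mapping_eqI) (auto simp: lookup_add lookup_minus lookup_single when_def)
    then show ?thesis by simp
  qed simp
  show "d_fvar k (Poly_Mapping.single (\<mu> + \<nu>) (a * b)) =
      Poly_Mapping.single \<mu> a * d_fvar k (Poly_Mapping.single \<nu> b)
      + d_fvar k (Poly_Mapping.single \<mu> a) * Poly_Mapping.single \<nu> b" for \<mu> \<nu> and a b :: "'a smooth_fun"
    using m[of \<mu> \<nu> "a * b"] m[of \<nu> \<mu> "a * b"]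
    by (simp add: d mult_single lookup_add distrib_right distrib_left single_add add_ac mult_ac)
qed (auto intro!: poly_mapping_eqI simp: lookup_d_fvar lookup_add algebra_simps)

lemma d_coord_commute: "d_coord i (d_coord j \<eta>) = d_coord j (d_coord i \<eta>)"
  by (intro poly_mapping_eqI) (simp add: lookup_d_coord sf_partial_commute)

lemma d_fvar_commute: "d_fvar k (d_fvar l \<eta>) = d_fvar l (d_fvar k \<eta>)"
  by (intro poly_mapping_eqI) (auto simp: lookup_d_fvar lookup_add lookup_single when_def add_ac mult_ac)

lemma d_coord_fvar_commute: "d_coord i (d_fvar k \<eta>) = d_fvar k (d_coord i \<eta>)"
proof (intro poly_mapping_eqI)
  interpret hom_derivation "\<lambda>f. f" "sf_partial i" by (rule sf_derivation)
  show "Poly_Mapping.lookup (d_coord i (d_fvar k \<eta>)) \<mu> = Poly_Mapping.lookup (d_fvar k (d_coord i \<eta>)) \<mu>" for \<mu>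
    by (simp add: lookup_d_coord lookup_d_fvar mult add)
qed

lemma d_coord_coeff_fun: "d_coord i (coeff_fun g) = coeff_fun (sf_partial i g)"
  by (intro poly_mapping_eqI) (auto simp: lookup_d_coord coeff_fun_def lookup_single when_def)

lemma d_fvar_coeff_fun [simp]: "d_fvar k (coeff_fun g) = 0"
  by (simp add: d_fvar_def coeff_fun_def)

lemma d_coord_fvar [simp]: "d_coord i (fvar k) = 0"
proof (intro poly_mapping_eqI)
  interpret hom_derivation "\<lambda>f. f" "sf_partial i" by (rule sf_derivation)
  show "Poly_Mapping.lookup (d_coord i (fvar k)) \<mu> = Poly_Mapping.lookup 0 \<mu>" for \<mu>
    by (simp add: lookup_d_coord fvar_def lookup_single when_def)
qed

lemma d_fvar_fvar: "d_fvar k (fvar l) = (if k = l then 1 else 0)"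
  by (simp add: d_fvar_def fvar_def lookup_single when_def)

lemma coeff_fun_mult: "coeff_fun (f * g) = coeff_fun f * coeff_fun g"
  by (simp add: coeff_fun_def mult_single)

lemma coeff_fun_add: "coeff_fun (f + g) = coeff_fun f + coeff_fun g"
  by (simp add: coeff_fun_def single_add)

lemma coeff_fun_diff: "coeff_fun (f - g) = coeff_fun f - coeff_fun g"
  by (simp add: coeff_fun_def single_diff)

lemma coeff_fun_0 [simp]: "coeff_fun 0 = 0" and coeff_fun_1 [simp]: "coeff_fun 1 = 1"
  by (simp_all add: coeff_fun_def)

lemma scalar_add: "scalar (a + b) = scalar a + scalar b"
  by (simp add: scalar_def sf_const_add coeff_fun_add)

lemma scalar_mult: "scalar (a * b) = scalar a * scalar b"
  by (simp add: scalar_def sf_const_mult coeff_fun_mult)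

lemma scalar_1 [simp]: "scalar 1 = 1"
  by (simp add: scalar_def sf_const_1)

lemma d_coord_scalar [simp]: "d_coord i (scalar a) = 0"
  by (simp add: scalar_def d_coord_coeff_fun sf_partial_const)

lemma d_fvar_scalar [simp]: "d_fvar k (scalar a) = 0"
  by (simp add: scalar_def)

lemma d_coord_coord: "d_coord i (coord j) = (if i = j then 1 else 0)"
  by (simp add: coord_def d_coord_coeff_fun sf_partial_coord)

lemma d_fvar_coord [simp]: "d_fvar k (coord j) = 0"
  by (simp add: coord_def)

lemma d_fvar_inv_diff [simp]: "d_fvar k (inv_diff j i) = 0"
  by (simp add: inv_diff_def)

lemma inv_diff: "j \<noteq> i \<Longrightarrow> (coord j - coord i) * inv_diff j i = 1"
  unfolding inv_diff_def coord_def
  by (simp add: sf_inv_diff mult.commute flip: coeff_fun_diff coeff_fun_mult)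

lemma d_coord_inv_diff:
  assumes "j \<noteq> i"
  shows "d_coord l (inv_diff j i) = (inv_diff j i)\<^sup>2 * ((if l = i then 1 else 0) - (if l = j then 1 else 0))"
  using d_coord.inverse[OF inv_diff[OF assms], of l] assms
  by (auto simp: d_coord.diff d_coord_coord)

lemma fls_const_hom: "comm_ring_hom (fls_const :: 'a::comm_ring_1 \<Rightarrow> 'a fls)"
  by unfold_locales (simp_all add: fls_plus_const)

lemma fls_map_id: "fls_map (\<lambda>x. x) = (\<lambda>f. f)"
  by (rule ext) simp

lemma fls_map_derivation: "hom_derivation (\<lambda>x. x) D \<Longrightarrow> hom_derivation (\<lambda>f. f) (fls_map D)"
  using hom_derivation.fls_map_hom_derivation[of "\<lambda>x. x" D] by (simp add: fls_map_id)

lemma fls_map_fls_const_commute: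
  assumes "h 0 = 0"
  shows "fls_map (fls_map h) (fls_map fls_const f) = fls_map fls_const (fls_map h f)"
proof -
  have "fls_map h 0 = 0" using fls_map_const[of h 0] assms by simp
  then show ?thesis using assms by (simp add: fls_map_compose fls_map_const)
qed

section \<open>Vector fields in the variables \<open>f\<^sub>m\<close>\<close>

text \<open>A first-order operator with coefficients P k in a possibly larger ring. The index set
  depends on \<eta> as in the definitions of \<open>L_op\<close> and \<open>A_op\<close>.\<close>

definition vfield :: "('k::{finite,linorder} alg \<Rightarrow> 'b::comm_ring_1) \<Rightarrow> (nat \<Rightarrow> 'b) \<Rightarrow> 'k alg \<Rightarrow> 'b" where
  "vfield \<phi> P \<eta> = (\<Sum>k | d_fvar k \<eta> \<noteq> 0. P k * \<phi> (d_fvar k \<eta>))"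

lemma finite_d_fvar: "finite {k. d_fvar k \<eta> \<noteq> 0}"
proof (rule finite_subset)
  show "{k. d_fvar k \<eta> \<noteq> 0} \<subseteq> (\<Union>\<mu>\<in>Poly_Mapping.keys \<eta>. Poly_Mapping.keys \<mu>)"
  proof (rule subsetI, rule ccontr)
    fix k assume k: "k \<in> {k. d_fvar k \<eta> \<noteq> 0}"
      and *: "k \<notin> (\<Union>\<mu>\<in>Poly_Mapping.keys \<eta>. Poly_Mapping.keys \<mu>)"
    have "Poly_Mapping.lookup \<mu> k = 0" if "\<mu> \<in> Poly_Mapping.keys \<eta>" for \<mu>
      using * that by (auto simp: in_keys_iff)
    then have "d_fvar k \<eta> = 0" unfolding d_fvar_def by (intro sum.neutral) simp
    then show False using k by simp
  qed
qed simp

lemma vfield_eq_sum: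
  assumes "\<phi> 0 = 0" "finite K" "\<And>k. k \<notin> K \<Longrightarrow> d_fvar k \<eta> = 0"
  shows "vfield \<phi> P \<eta> = (\<Sum>k\<in>K. P k * \<phi> (d_fvar k \<eta>))"
  unfolding vfield_def using assms by (intro sum.mono_neutral_left) auto

lemma vfield_eq_0: "(\<And>k. d_fvar k \<eta> = 0) \<Longrightarrow> vfield \<phi> P \<eta> = 0"
  by (simp add: vfield_def)

lemma vfield_fvar: "\<phi> 0 = 0 \<Longrightarrow> \<phi> 1 = 1 \<Longrightarrow> vfield \<phi> P (fvar k) = P k"
  by (subst vfield_eq_sum[where K = "{k}"]) (auto simp: d_fvar_fvar)

lemma vfield_derivation:
  assumes "comm_ring_hom \<phi>"
  shows "hom_derivation \<phi> (vfield \<phi> P)"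
proof -
  interpret \<phi>: comm_ring_hom \<phi> by fact
  show ?thesis
  proof
    fix a b :: "'a alg"
    \<comment> \<open>A common finite index set for a, b, their sum and their product; added indices
      contribute 0.\<close>
    let ?K = "{k. d_fvar k a \<noteq> 0} \<union> {k. d_fvar k b \<noteq> 0}"
    have *: "vfield \<phi> P \<eta> = (\<Sum>k\<in>?K. P k * \<phi> (d_fvar k \<eta>))"
      if "\<eta> \<in> {a, b, a + b, a * b}" for \<eta>
      using that by (intro vfield_eq_sum) (auto simp: finite_d_fvar \<phi>.hom_0 d_fvar.add d_fvar.mult)
    show "vfield \<phi> P (a + b) = vfield \<phi> P a + vfield \<phi> P b"
      by (simp add: * d_fvar.add \<phi>.hom_add algebra_simps flip: sum.distrib)
    show "vfield \<phi> P (a * b) = \<phi> a * vfield \<phi> P b + vfield \<phi> P a * \<phi> b"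
      by (simp add: * d_fvar.mult \<phi>.hom_add \<phi>.hom_mult sum_distrib_left sum_distrib_right algebra_simps
          flip: sum.distrib)
  qed
qed

text \<open>The coefficient of z^(-1-k) in f is the indeterminate number k, so a vector field can be
  prescribed through the image G of f. The leading term z is annihilated, hence G may contain only
  negative powers of z.\<close>

lemma fls_map_vfield_f_ser:
  assumes "comm_ring_hom \<phi>" and G: "\<And>n. n \<le> 0 \<Longrightarrow> fls_nth G n = 0"
  shows "fls_map (vfield \<phi> (\<lambda>k. fls_nth G (1 + int k))) f_ser = G"
proof (rule fls_eqI)
  fix n
  interpret \<phi>: comm_ring_hom \<phi> by fact
  interpret v: hom_derivation \<phi> "vfield \<phi> P" for P by (rule vfield_derivation) fact
  show "fls_nth (fls_map (vfield \<phi> (\<lambda>k. fls_nth G (1 + int k))) f_ser) n = fls_nth G n"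
    by (simp add: G fls_nth_map f_ser_def fseries_nth vfield_fvar \<phi>.hom_0 \<phi>.hom_1)
qed

lemma vfield_scalar [simp]: "vfield \<phi> P (scalar a) = 0"
  and vfield_coord [simp]: "vfield \<phi> P (coord j) = 0"
  and vfield_inv_diff [simp]: "vfield \<phi> P (inv_diff j i) = 0"
  by (simp_all add: vfield_eq_0)

section \<open>The building blocks of the operators\<close>

definition pole :: "'k \<Rightarrow> 'k::{finite,linorder} alg fls" where
  "pole j = expansion 0 f_ser (coord j)"

definition pole_outer :: "'k::{finite,linorder} alg fls fls" where
  "pole_outer = expansion 0 f_ser_outer f_ser"

text \<open>
  \<open>vf_point j\<close> is the derivation with \<open>f(z) \<mapsto> 1 / (f(z) - x\<^sub>j)\<close>, and \<open>vf_series\<close> the one with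
  \<open>f(z) \<mapsto> 1 / (f(z) - f(u))\<close>.
\<close>

definition vf_point :: "'k \<Rightarrow> 'k alg \<Rightarrow> 'k::{finite,linorder} alg" where
  "vf_point j = vfield (\<lambda>\<eta>. \<eta>) (\<lambda>k. p_coeff k j)"

definition vf_series :: "'k alg \<Rightarrow> 'k::{finite,linorder} alg fls" where
  "vf_series = vfield fls_const (\<lambda>k. fls_nth pole_outer (1 + int k))"

text \<open>The derivation with f(z) -> 1 / (f(z) - x_j)^2. It arises when d/dx_j hits the
  coefficients of \<open>vf_point j\<close>.\<close>

definition vf_double_pole :: "'k \<Rightarrow> 'k alg \<Rightarrow> 'k::{finite,linorder} alg" where
  "vf_double_pole j = vfield (\<lambda>\<eta>. \<eta>) (\<lambda>k. fls_nth ((pole j)\<^sup>2) (1 + int k))"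

lemma id_hom: "comm_ring_hom (\<lambda>x :: 'a::comm_ring_1. x)"
  by unfold_locales simp_all

interpretation vf_point: hom_derivation "\<lambda>\<eta>. \<eta>" "vf_point j"
  unfolding vf_point_def by (intro vfield_derivation id_hom)

interpretation vf_series: hom_derivation fls_const vf_series
  unfolding vf_series_def by (intro vfield_derivation fls_const_hom)

interpretation dz: hom_derivation "\<lambda>f. f" dz
  by (rule dz_hom_derivation)

interpretation dc: hom_derivation "\<lambda>f. f" "fls_map (d_coord j)"
  by (intro fls_map_derivation d_coord.hom_derivation_axioms)

interpretation vp: hom_derivation "\<lambda>f. f" "fls_map (vf_point j)"
  by (intro fls_map_derivation vf_point.hom_derivation_axioms)

lemma pole: "(f_ser - fls_const (coord j)) * pole j = 1"
  unfolding pole_def f_ser_def by (rule expansion_fseries_0)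

lemma pole_outer: "(f_ser_outer - fls_const f_ser) * pole_outer = 1"
  unfolding pole_outer_def f_ser_outer_def by (rule expansion_fseries_0)

lemma expansion_1_pole: "expansion 1 f_ser (coord j) = (pole j)\<^sup>2"
  unfolding pole_def f_ser_def by (rule expansion_fseries_1)

lemma p_coeff: "p_coeff k j = fls_nth (pole j) (1 + int k)"
  by (simp add: p_coeff_def Res_zpow pole_def)

lemma f_ser_outer: "f_ser_outer = fls_map fls_const f_ser"
  by (simp add: f_ser_outer_def f_ser_def fls_map_fseries)

lemma dc_f_ser [simp]: "fls_map (d_coord j) f_ser = 0"
  by (intro fls_eqI) (simp add: fls_nth_map f_ser_def fseries_nth)

lemma vp_f_ser: "fls_map (vf_point j) f_ser = pole j"
  unfolding vf_point_def p_coeff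
  by (intro fls_map_vfield_f_ser id_hom) (simp add: pole_def expansion_nth_eq_0)

lemma vs_f_ser: "fls_map vf_series f_ser = pole_outer"
  unfolding vf_series_def
  by (intro fls_map_vfield_f_ser fls_const_hom) (simp add: pole_outer_def expansion_nth_eq_0)

lemma dc_const: "fls_map (d_coord j) (fls_const a) = fls_const (d_coord j a)"
  and vp_const: "fls_map (vf_point j) (fls_const a) = fls_const (vf_point j a)"
  by (simp_all add: fls_map_const)

lemma dc_pole: "fls_map (d_coord l) (pole j) = (if l = j then (pole j)\<^sup>2 else 0)"
  using dc.inverse[OF pole, of l j] by (simp add: dc.diff dc_const d_coord_coord)

lemma vf_point_coord [simp]: "vf_point j (coord l) = 0"
  and vf_point_scalar [simp]: "vf_point j (scalar a) = 0"
  and vf_point_inv_diff [simp]: "vf_point j (inv_diff l m) = 0"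
  by (simp_all add: vf_point_def)

lemma vf_series_coord [simp]: "vf_series (coord l) = 0"
  and vf_series_scalar [simp]: "vf_series (scalar a) = 0"
  and vf_series_inv_diff [simp]: "vf_series (inv_diff l m) = 0"
  by (simp_all add: vf_series_def)

lemma vp_pole: "fls_map (vf_point i) (pole j) = - ((pole j)\<^sup>2 * pole i)"
  using vp.inverse[OF pole, of i j] by (simp add: vp.diff vp_const vp_f_ser)

lemma dz_pole: "dz (pole j) = - ((pole j)\<^sup>2 * dz f_ser)"
  using dz.inverse[OF pole, of j] by (simp add: dz.diff)

lemma dc_dz_f_ser: "fls_map (d_coord j) (dz f_ser) = 0"
  by (simp add: d_coord.fls_map_dz)

lemma vp_dz_f_ser: "fls_map (vf_point i) (dz f_ser) = - ((pole i)\<^sup>2 * dz f_ser)"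
  by (simp add: vf_point.fls_map_dz vp_f_ser dz_pole)

lemma dc_schwarzian: "fls_map (d_coord j) (schwarzian f_ser) = 0"
proof -
  have "fls_map (d_coord j) (monic_inv (dz f_ser)) = 0"
    using dc.inverse[OF monic_inv_dz_fseries[of fvar, folded f_ser_def], of j] by (simp add: dc_dz_f_ser)
  then show ?thesis
    by (simp add: schwarzian_def dc.diff dc.mult dc.power2 d_coord.fls_map_dz dc_const)
qed

lemma scalar_0 [simp]: "scalar 0 = 0"
  using scalar_add[of 0 0] by simp

lemma scalar_diff: "scalar (a - b) = scalar a - scalar b"
  by (metis add_diff_cancel_right' diff_add_cancel scalar_add)

lemma scalar_of_nat: "scalar (of_nat n) = of_nat n"
  by (induction n) (simp_all add: scalar_add)

lemma scalar_numeral: "scalar (numeral n) = numeral n"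
  using scalar_of_nat[of "numeral n"] by simp

text \<open>This is the infinitesimal composition law of the Schwarzian: under f -> f + t v(f), S f
  changes to first order in t by f'^2 v'''(f). Here v(w) = 1 / (w - x_i), so v'''(w) = - 6 / (w -
  x_i)^4.\<close>

lemma vp_schwarzian:
  fixes i :: "'k::{finite,linorder}"
  shows "fls_map (vf_point i) (schwarzian f_ser) = - 6 * ((dz f_ser)\<^sup>2 * (pole i ^ 4))"
proof -
  let ?g = "pole i" and ?v = "monic_inv (dz f_ser) :: 'k alg fls"
  let ?f1 = "dz f_ser :: 'k alg fls" and ?f2 = "dz (dz f_ser) :: 'k alg fls"
    and ?f3 = "dz (dz (dz f_ser)) :: 'k alg fls"
  have v: "?f1 * ?v = 1" using monic_inv_dz_fseries[of fvar] by (simp add: f_ser_def)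
  have dv: "fls_map (vf_point i) ?v = ?g\<^sup>2 * (?f1 * ?v) * ?v"
    using vp.inverse[OF v, of i] by (simp add: vp_dz_f_ser power2_eq_square algebra_simps)
  have d2: "fls_map (vf_point i) ?f2 = 2 * ?g ^ 3 * ?f1\<^sup>2 - ?g\<^sup>2 * ?f2"
    by (simp add: vf_point.fls_map_dz vp_f_ser dz_pole dz.uminus dz.mult dz.power2)
      (simp add: power2_eq_square power3_eq_cube algebra_simps)
  have d3: "fls_map (vf_point i) ?f3 = - 6 * ?g ^ 4 * ?f1 ^ 3 + 6 * ?g ^ 3 * ?f1 * ?f2 - ?g\<^sup>2 * ?f3"
    by (simp add: vf_point.fls_map_dz vp_f_ser dz_pole dz.uminus dz.mult dz.power2 dz.add dz.diff)
      (simp add: power2_eq_square power3_eq_cube power4_eq_xxxx algebra_simps)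
  \<comment> \<open>The products f' v and f' v - 1 are kept as visible factors, so that f' v = 1 can
    be substituted afterwards.\<close>
  have "fls_map (vf_point i) (?f3 * ?v) = (?f1 * ?v) * (- 6 * ?g ^ 4 * ?f1\<^sup>2 + 6 * ?g ^ 3 * ?f2)
      + ((?f1 * ?v) - 1) * ?g\<^sup>2 * ?f3 * ?v"
    unfolding vp.mult d3 dv by (simp add: power2_eq_square power3_eq_cube algebra_simps)
  then have t1: "fls_map (vf_point i) (?f3 * ?v) = - 6 * ?g ^ 4 * ?f1\<^sup>2 + 6 * ?g ^ 3 * ?f2"
    unfolding v by simp
  have "fls_map (vf_point i) (?f2 * ?v) = (?f1 * ?v) * (2 * ?g ^ 3 * ?f1)
      + ((?f1 * ?v) - 1) * ?g\<^sup>2 * ?f2 * ?v"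
    unfolding vp.mult d2 dv by (simp add: power2_eq_square power3_eq_cube algebra_simps)
  then have t2: "fls_map (vf_point i) (?f2 * ?v) = 2 * ?g ^ 3 * ?f1"
    unfolding v by simp
  \<comment> \<open>The scalar 3/2 is an embedded complex number, not a quotient in the ring.
    Differentiating the square doubles it, which gives the integer 3.\<close>
  have r: "2 * fls_const (rscalar (3 / 2) :: 'k alg) = 3"
  proof -
    have "2 * (rscalar (3 / 2) :: 'k alg) = 3"
      using scalar_mult[of 2 "3 / 2"] by (simp add: scalar_numeral)
    then show ?thesis by (metis fls_const_mult_const fls_const_numeral)
  qed
  have "fls_map (vf_point i) (schwarzian f_ser) = - 6 * ?g ^ 4 * ?f1\<^sup>2 + 6 * ?g ^ 3 * ?f2
      - (2 * fls_const (rscalar (3 / 2))) * ((?f1 * ?v) * (2 * ?g ^ 3 * ?f2))"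
    unfolding schwarzian_def
      vp.diff t1 vp.mult[of _ "fls_const _"] vp.power2 t2 vp_const
    by (simp add: algebra_simps)
  also have "\<dots> = - 6 * (?f1\<^sup>2 * ?g ^ 4)"
    unfolding r v by (simp add: algebra_simps)
  finally show ?thesis .
qed

lemma dc_pole_outer: "fls_map (d_coord j) (fls_nth pole_outer n) = 0"
proof -
  interpret dd: hom_derivation "\<lambda>f. f" "fls_map (fls_map (d_coord j))"
    by (intro fls_map_derivation d_coord.hom_derivation_axioms)
  have "fls_map (fls_map (d_coord j)) f_ser_outer = 0"
    unfolding f_ser_outer by (simp add: fls_map_fls_const_commute fls_map_const[of fls_const 0, simplified])
  then have "fls_map (fls_map (d_coord j)) pole_outer = 0"
    using dd.inverse[OF pole_outer] by (simp add: dd.diff fls_map_const)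
  then show ?thesis by (metis dc.zero fls_nth_map fls_zero_nth)
qed

section \<open>Commutators\<close>

text \<open>For \<zeta> derived from \<eta>, such as a derivative of \<eta>, the sum may run over
  the indices of \<eta>. Commutators can then be compared term by term.\<close>

lemma vfield_apply_hom:
  assumes \<phi>: "comm_ring_hom \<phi>" and \<phi>': "\<And>k. d_fvar k \<eta> = 0 \<Longrightarrow> d_fvar k \<zeta> = 0"
  shows "vfield \<phi> P \<zeta> = (\<Sum>k | d_fvar k \<eta> \<noteq> 0. P k * \<phi> (d_fvar k \<zeta>))"
  using comm_ring_hom.hom_0[OF \<phi>] \<phi>' by (intro vfield_eq_sum finite_d_fvar) auto

lemma dc_vf_series: "fls_map (d_coord j) (vf_series \<eta>) = vf_series (d_coord j \<eta>)"
proof -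
  have "vf_series (d_coord j \<eta>) = (\<Sum>k | d_fvar k \<eta> \<noteq> 0. fls_nth pole_outer (1 + int k) * fls_const (d_coord j (d_fvar k \<eta>)))"
    unfolding vf_series_def
    by (subst vfield_apply_hom[where \<eta> = \<eta>]) (simp_all add: fls_const_hom flip: d_coord_fvar_commute)
  then show ?thesis
    unfolding vf_series_def vfield_def by (simp add: dc.sum dc.mult dc_pole_outer dc_const)
qed

text \<open>The extra term is the derivative of the coefficients: d/dx_j of 1 / (f - x_j) is 1 / (f
  - x_j)^2.\<close>

lemma d_coord_vf_point:
  "d_coord l (vf_point j \<eta>) = vf_point j (d_coord l \<eta>) + (if l = j then vf_double_pole j \<eta> else 0)"
proof -
  have p: "d_coord l (p_coeff k j) = (if l = j then fls_nth ((pole j)\<^sup>2) (1 + int k) else 0)" for k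
    unfolding p_coeff fls_nth_map[of "d_coord l", OF d_coord.zero, symmetric] dc_pole by simp
  have "vf_point j (d_coord l \<eta>) = (\<Sum>k | d_fvar k \<eta> \<noteq> 0. p_coeff k j * d_coord l (d_fvar k \<eta>))"
    unfolding vf_point_def
    by (subst vfield_apply_hom[where \<eta> = \<eta>]) (simp_all add: id_hom flip: d_coord_fvar_commute)
  then show ?thesis
    unfolding vf_point_def vf_double_pole_def vfield_def
    by (simp add: d_coord.sum d_coord.mult p sum.distrib)
qed

text \<open>
  The bracket of the vector fields \<open>1 / (f - x)\<close> and \<open>1 / (f - w)\<close>, evaluated on \<open>f(z)\<close>, with
  \<open>w = f(u)\<close>. It uses the resolvent identity \<open>1 / ((f - x) (f - w)) = (1 / (f - w) - 1 / (f - x)) / (w - x)\<close>.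
\<close>

lemma vf_bracket_coeff:
  fixes i :: "'k::{finite,linorder}"
  shows "vf_series (p_coeff k i) - fls_map (vf_point i) (fls_nth pole_outer (1 + int k)) =
    pole i * fls_const (fls_nth ((pole i)\<^sup>2) (1 + int k))
      - 2 * (pole i)\<^sup>2 * (fls_nth pole_outer (1 + int k) - fls_const (p_coeff k i))"
proof -
  interpret cc: comm_ring_hom "fls_map fls_const :: 'k alg fls \<Rightarrow> 'k alg fls fls"
    using vf_series.fls_map_hom_derivation by (rule hom_derivation.axioms)
  interpret ss: hom_derivation "fls_map fls_const" "fls_map (vf_series :: 'k alg \<Rightarrow> _)"
    by (rule vf_series.fls_map_hom_derivation)
  interpret pp: hom_derivation "\<lambda>f. f" "fls_map (fls_map (vf_point i))"
    by (intro fls_map_derivation vf_point.hom_derivation_axioms)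
  \<comment> \<open>G = 1 / (f(z) - x_i) is lifted to series in z with coefficients constant in u, H
    = 1 / (f(z) - f(u)), and g = 1 / (f(u) - x_i) is constant in z.\<close>
  define G H g where "G = fls_map fls_const (pole i)" and "H = (pole_outer :: 'k alg fls fls)"
    and "g = fls_const (pole i)"
  define x w where "x = fls_const (fls_const (coord i) :: 'k alg fls)" and "w = fls_const (f_ser :: 'k alg fls)"
  have xx: "fls_map fls_const (fls_const (coord i)) = x"
    by (simp add: x_def fls_map_const)
  have hom_diff: "fls_map fls_const (a - b) = fls_map fls_const a - fls_map fls_const b" for a b :: "'k alg fls"
    using cc.hom_add[of "a - b" b] by simp
  have G1: "(f_ser_outer - x) * G = 1"
    using arg_cong[OF pole[of i], of "fls_map fls_const"]
    by (simp add: cc.hom_mult hom_diff cc.hom_1 f_ser_outer xx G_def)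
  have H1: "(f_ser_outer - w) * H = 1"
    using pole_outer by (simp add: w_def H_def)
  have g1: "(w - x) * g = 1"
  proof -
    have "(w - x) * g = fls_const ((f_ser - fls_const (coord i)) * pole i)"
      by (simp add: w_def x_def g_def fls_minus_const)
    then show ?thesis unfolding pole by simp
  qed
  have GH: "G * H = g * (H - G)"
  proof -
    have "H - G = (((f_ser_outer - x) * G) * H) - ((f_ser_outer - w) * H) * G"
      unfolding G1 H1 by simp
    also have "\<dots> = (w - x) * (G * H)"
      by (simp add: algebra_simps)
    finally have "g * (H - G) = ((w - x) * g) * (G * H)"
      by (simp only: mult_ac)
    then show ?thesis unfolding g1 by simp
  qed
  have sG: "fls_map vf_series (pole i) = - (G\<^sup>2 * H)"
    using ss.inverse[OF pole, of i] by (simp add: ss.diff fls_map_const vs_f_ser G_def H_def)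
  \<comment> \<open>Here both f(z) and f(u) vary, by G and by g, whence the difference G -
    g.\<close>
  have pH: "fls_map (fls_map (vf_point i)) H = - (H\<^sup>2 * (G - g))"
    using pp.inverse[OF H1] unfolding w_def f_ser_outer pp.diff
    by (simp add: fls_map_fls_const_commute vp_f_ser fls_map_const G_def g_def)
  \<comment> \<open>One use of the resolvent identity turns both cubic terms into g times quadratic
    ones, after which the terms g H^2 cancel.\<close>
  have "G\<^sup>2 * H = G * (G * H)" "H\<^sup>2 * G = H * (G * H)"
    by (simp_all add: power2_eq_square mult_ac)
  moreover have "G * (G * H) = G * (g * (H - G))" "H * (G * H) = H * (g * (H - G))"
    by (simp_all only: GH)
  moreover have "G * (g * (H - G)) = g * (G * H) - g * G\<^sup>2" "H * (g * (H - G)) = g * H\<^sup>2 - g * (G * H)"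
    by (simp_all add: algebra_simps power2_eq_square)
  ultimately have e: "G\<^sup>2 * H = g * (G * H) - g * G\<^sup>2" "H\<^sup>2 * G = g * H\<^sup>2 - g * (G * H)"
    by (simp_all only:)
  have "- (G\<^sup>2 * H) + H\<^sup>2 * (G - g) = H\<^sup>2 * G - G\<^sup>2 * H - g * H\<^sup>2"
    by (simp add: algebra_simps)
  also have "\<dots> = g * G\<^sup>2 - 2 * g * (G * H)"
    unfolding e by simp
  finally have "- (G\<^sup>2 * H) + H\<^sup>2 * (G - g) = g * G\<^sup>2 - 2 * g * (G * H)" .
  then have "fls_map vf_series (pole i) - fls_map (fls_map (vf_point i)) H = g * G\<^sup>2 - 2 * g\<^sup>2 * (H - G)"
    unfolding sG pH by (simp add: GH power2_eq_square algebra_simps)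
  moreover have "G\<^sup>2 = fls_map fls_const ((pole i)\<^sup>2)"
    by (simp add: G_def power2_eq_square cc.hom_mult)
  moreover have "2 * g\<^sup>2 = fls_const (2 * (pole i)\<^sup>2)"
    by (simp add: g_def flip: fls_const_numeral fls_const_power)
  ultimately have "fls_nth (fls_map vf_series (pole i) - fls_map (fls_map (vf_point i)) H) (1 + int k) =
      fls_nth (fls_const (pole i) * fls_map fls_const ((pole i)\<^sup>2)
        - fls_const (2 * (pole i)\<^sup>2) * (H - fls_map fls_const (pole i))) (1 + int k)"
    by (simp only: g_def[symmetric] G_def[symmetric])
  then show ?thesis
    by (simp add: fls_nth_map p_coeff H_def)
qed

text \<open>The second-order parts of the two compositions agree, since the derivatives in the f_m
  commute. What is left is the first-order operator whose coefficients are given by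
  \<open>vf_bracket_coeff\<close>.\<close>

lemma vp_vf_series:
  "fls_map (vf_point i) (vf_series \<eta>) = vf_series (vf_point i \<eta>)
     - pole i * fls_const (vf_double_pole i \<eta>)
     + 2 * (pole i)\<^sup>2 * (vf_series \<eta> - fls_const (vf_point i \<eta>))"
proof -
  let ?K = "{k. d_fvar k \<eta> \<noteq> 0}" and ?P = "\<lambda>k. fls_nth pole_outer (1 + int k)"
  have K0: "d_fvar k (d_fvar l \<eta>) = 0" if "d_fvar k \<eta> = 0" for k l
    using that by (simp add: d_fvar_commute[of k])
  have vs: "vf_series (d_fvar l \<eta>) = (\<Sum>k\<in>?K. ?P k * fls_const (d_fvar k (d_fvar l \<eta>)))" for l
    unfolding vf_series_def by (rule vfield_apply_hom[OF fls_const_hom K0])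
  have vp: "vf_point i (d_fvar l \<eta>) = (\<Sum>k\<in>?K. p_coeff k i * d_fvar k (d_fvar l \<eta>))" for l
    unfolding vf_point_def by (rule vfield_apply_hom[OF id_hom K0])
  have const_sum: "fls_const (sum F K) = (\<Sum>k\<in>K. fls_const (F k))" for F :: "nat \<Rightarrow> 'a alg" and K
    by (induction K rule: infinite_finite_induct) (simp_all flip: fls_plus_const)
  have "(\<Sum>k\<in>?K. ?P k * fls_const (vf_point i (d_fvar k \<eta>)))
      = (\<Sum>k\<in>?K. \<Sum>l\<in>?K. ?P k * fls_const (p_coeff l i) * fls_const (d_fvar k (d_fvar l \<eta>)))"
    unfolding vp const_sum by (simp add: sum_distrib_left mult.assoc d_fvar_commute)
  also have "\<dots> = (\<Sum>l\<in>?K. fls_const (p_coeff l i) * vf_series (d_fvar l \<eta>))"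
    unfolding vs sum_distrib_left by (subst sum.swap) (simp only: mult_ac)
  finally have second_order: "(\<Sum>k\<in>?K. ?P k * fls_const (vf_point i (d_fvar k \<eta>)))
      = (\<Sum>l\<in>?K. fls_const (p_coeff l i) * vf_series (d_fvar l \<eta>))" .
  have E: "vf_point i \<eta> = (\<Sum>k\<in>?K. p_coeff k i * d_fvar k \<eta>)"
    by (simp add: vf_point_def vfield_def)
  have E': "vf_double_pole i \<eta> = (\<Sum>k\<in>?K. fls_nth ((pole i)\<^sup>2) (1 + int k) * d_fvar k \<eta>)"
    by (simp add: vf_double_pole_def vfield_def)
  have B: "vf_series \<eta> = (\<Sum>k\<in>?K. ?P k * fls_const (d_fvar k \<eta>))"
    by (simp add: vf_series_def vfield_def)
  have "fls_map (vf_point i) (vf_series \<eta>) - vf_series (vf_point i \<eta>)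
      = (\<Sum>k\<in>?K. - (vf_series (p_coeff k i) - fls_map (vf_point i) (?P k)) * fls_const (d_fvar k \<eta>))"
    unfolding B[of] E vp.sum vf_series.sum vp.mult vf_series.mult vp_const
    by (simp add: sum.distrib second_order sum_subtractf sum_negf algebra_simps)
  also have "\<dots> = - pole i * fls_const (vf_double_pole i \<eta>)
      + 2 * (pole i)\<^sup>2 * (vf_series \<eta> - fls_const (vf_point i \<eta>))"
    unfolding vf_bracket_coeff
    unfolding E E' B const_sum sum_distrib_left sum_subtractf[symmetric] sum.distrib[symmetric]
    by (intro sum.cong) (simp_all add: algebra_simps flip: fls_const_mult_const)
  finally show ?thesis by (simp add: algebra_simps)
qed

lemma fls_const_sum: "fls_const (sum F K) = (\<Sum>k\<in>K. fls_const (F k))"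
  for F :: "'i \<Rightarrow> 'a::comm_ring_1"
  by (induction K rule: infinite_finite_induct) (simp_all flip: fls_plus_const)

lemma fls_const_distrib:
  fixes a b :: "'a::comm_ring_1"
  shows "fls_const (a + b) = fls_const a + fls_const b"
    and "fls_const (a - b) = fls_const a - fls_const b"
    and "fls_const (a * b) = fls_const a * fls_const b"
    and "fls_const (a\<^sup>2) = (fls_const a)\<^sup>2"
  by (simp_all flip: fls_plus_const add: fls_minus_const power2_eq_square)

declare fls_const_mult_const [simp del]

section \<open>The operators as elements of the series ring\<close>

definition loewner_pair :: "('k \<Rightarrow> real) \<Rightarrow> 'k \<Rightarrow> 'k \<Rightarrow> 'k alg \<Rightarrow> 'k::{finite,linorder} alg" where
  "loewner_pair \<delta> i l \<eta> = 2 * inv_diff l i * d_coord l \<eta> - rscalar (2 * \<delta> l) * (inv_diff l i)\<^sup>2 * \<eta>"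

text \<open>The operator \<open>A_op\<close> with the two kinds of points merged into one sum,
  possible because (\<kappa>_l - 6) / \<kappa>_l = - 2 \<delta>_l for an x-coordinate.\<close>

definition loewner :: "real \<Rightarrow> ('k \<Rightarrow> real) \<Rightarrow> 'k \<Rightarrow> 'k alg \<Rightarrow> 'k::{finite,linorder} alg" where
  "loewner \<kappa> \<delta> i \<eta> = rscalar (\<kappa> / 2) * d_coord i (d_coord i \<eta>)
     + (\<Sum>l\<in>- {i}. loewner_pair \<delta> i l \<eta>) + 2 * vf_point i \<eta>"

definition loewner_pair_ser :: "('k \<Rightarrow> real) \<Rightarrow> 'k \<Rightarrow> 'k \<Rightarrow> 'k alg fls \<Rightarrow> 'k::{finite,linorder} alg fls" where
  "loewner_pair_ser \<delta> i l Y = 2 * fls_const (inv_diff l i) * fls_map (d_coord l) Y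
     - fls_const (rscalar (2 * \<delta> l)) * (fls_const (inv_diff l i))\<^sup>2 * Y"

text \<open>The same operator acting coefficientwise on series in u. It is written with derivations
  of the series ring, so that the Leibniz rule applies to poles and f'(u).\<close>

definition loewner_ser :: "real \<Rightarrow> ('k \<Rightarrow> real) \<Rightarrow> 'k \<Rightarrow> 'k alg fls \<Rightarrow> 'k::{finite,linorder} alg fls" where
  "loewner_ser \<kappa> \<delta> i Y = fls_const (rscalar (\<kappa> / 2)) * fls_map (d_coord i) (fls_map (d_coord i) Y)
     + (\<Sum>l\<in>- {i}. loewner_pair_ser \<delta> i l Y) + 2 * fls_map (vf_point i) Y"

definition virasoro_pole :: "('k \<Rightarrow> real) \<Rightarrow> 'k \<Rightarrow> 'k alg \<Rightarrow> 'k::{finite,linorder} alg fls" where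
  "virasoro_pole \<delta> j \<eta> = (dz f_ser)\<^sup>2 *
     (fls_const (rscalar (\<delta> j)) * (pole j)\<^sup>2 * fls_const \<eta> + pole j * fls_const (d_coord j \<eta>))"

definition virasoro :: "real \<Rightarrow> ('k \<Rightarrow> real) \<Rightarrow> 'k alg \<Rightarrow> 'k::{finite,linorder} alg fls" where
  "virasoro c \<delta> \<eta> = fls_const (rscalar (c / 12)) * schwarzian f_ser * fls_const \<eta>
     - (dz f_ser)\<^sup>2 * vf_series \<eta> + (\<Sum>j\<in>UNIV. virasoro_pole \<delta> j \<eta>)"

text \<open>Multiplication by u^(1-n) and the residue pick out the coefficient of u^(n-2), which has
  number 2 - n in powers of 1/u.\<close>

lemma L_op_virasoro: "L_op c \<delta> n \<eta> = fls_nth (virasoro c \<delta> \<eta>) (2 - n)"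
proof -
  have "Res (fls_const ((dz f_ser)\<^sup>2) * zpow (int k) * expansion 0 f_ser_outer f_ser)
      = (dz f_ser)\<^sup>2 * fls_nth (pole_outer :: 'a alg fls fls) (1 + int k)" for k
    by (simp add: Res_def mult.assoc zpow_times_nth pole_outer_def)
  then show ?thesis
    unfolding L_op_def virasoro_def Res_zpow expansion_1_pole pole_def[symmetric]
    by (simp add: vf_series_def vfield_def virasoro_pole_def sum_distrib_left mult.assoc)
qed

lemma loewner_ser_nth: "fls_nth (loewner_ser \<kappa> \<delta> i Y) n = loewner \<kappa> \<delta> i (fls_nth Y n)"
  by (simp add: loewner_ser_def loewner_def loewner_pair_ser_def loewner_pair_def fls_nth_sum fls_nth_map
      mult.assoc flip: fls_const_power)

lemma A_op_loewner:
  assumes "i \<in> X" "\<And>j. j \<in> X \<Longrightarrow> \<kappa> j \<noteq> 0"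
    and "\<And>j. j \<in> X \<Longrightarrow> \<delta> j = (6 - \<kappa> j) / (2 * \<kappa> j)" "\<And>j. j \<notin> X \<Longrightarrow> \<delta> j = h j"
  shows "A_op X \<kappa> h i \<eta> = loewner (\<kappa> i) \<delta> i \<eta>"
proof -
  have "rscalar ((\<kappa> j - 6) / \<kappa> j) = - (rscalar (2 * \<delta> j) :: 'a alg)" if "j \<in> X" for j
  proof -
    have "(\<kappa> j - 6) / \<kappa> j = - (2 * \<delta> j)"
      using assms(2,3)[OF that] by (simp add: field_simps)
    then show ?thesis using scalar_diff[of 0 "complex_of_real (2 * \<delta> j)"] by simp
  qed
  moreover have "(\<Sum>l\<in>- {i}. loewner_pair \<delta> i l \<eta>)
      = (\<Sum>l\<in>X - {i}. loewner_pair \<delta> i l \<eta>) + (\<Sum>l\<in>- X. loewner_pair \<delta> i l \<eta>)"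
    using assms(1) by (subst sum.union_disjoint[symmetric]) (auto intro!: sum.cong)
  ultimately show ?thesis
    unfolding A_op_def D_op_def loewner_def vf_point_def vfield_def
    using assms(4) by (simp add: loewner_pair_def)
qed

text \<open>Here t stands for one summand of the generating series. The second derivative, the pair
  terms and the vector field can then be commuted past it separately.\<close>

lemma loewner_commutator_sum:
  assumes add: "\<And>a b. t (a + b) = t a + (t b :: 'k::{finite,linorder} alg fls)"
  shows "loewner_ser \<kappa> \<delta> i (t \<eta>) - t (loewner \<kappa> \<delta> i \<eta>) =
    (fls_const (rscalar (\<kappa> / 2)) * fls_map (d_coord i) (fls_map (d_coord i) (t \<eta>))
      - t (rscalar (\<kappa> / 2) * d_coord i (d_coord i \<eta>)))
    + (\<Sum>l\<in>- {i}. loewner_pair_ser \<delta> i l (t \<eta>) - t (loewner_pair \<delta> i l \<eta>))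
    + 2 * (fls_map (vf_point i) (t \<eta>) - t (vf_point i \<eta>))"
proof -
  have "t 0 = 0" using add[of 0 0] by simp
  then have "t (sum F I) = (\<Sum>l\<in>I. t (F l))" for F :: "'k \<Rightarrow> 'k alg" and I
    by (induction I rule: infinite_finite_induct) (simp_all add: add)
  then show ?thesis
    unfolding loewner_ser_def loewner_def mult_2 add by (simp add: sum_subtractf algebra_simps)
qed

section \<open>Commutators with the single summands of the generating series\<close>

lemmas const_simps = dc_const vp_const fls_const_distrib d_coord.mult d_coord.add d_coord.diff
  vf_point.mult vf_point.add vf_point.diff

lemma dz_f_ser_sq: "fls_map (d_coord l) ((dz f_ser)\<^sup>2) = 0"
  "fls_map (vf_point i) ((dz f_ser)\<^sup>2) = - 2 * (pole i)\<^sup>2 * (dz f_ser)\<^sup>2"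
  by (simp_all add: dc.power2 dc_dz_f_ser vp.power2 vp_dz_f_ser) (simp add: power2_eq_square algebra_simps)

lemma scalar_double [simp]: "scalar (2 * a) = 2 * scalar a"
  by (simp add: scalar_mult scalar_numeral)

text \<open>The Schwarzian does not involve the coordinates, so only the vector field 2
  \<open>vf_point i\<close> acts on it: - 12 = 2 * (- 6).\<close>

lemma commutator_schwarzian:
  "loewner_ser \<kappa> \<delta> i (fls_const (rscalar a) * schwarzian f_ser * fls_const \<eta>)
     - fls_const (rscalar a) * schwarzian f_ser * fls_const (loewner \<kappa> \<delta> i \<eta>)
   = - 12 * fls_const (rscalar a) * (dz f_ser)\<^sup>2 * pole i ^ 4 * fls_const \<eta>"
  by (subst loewner_commutator_sum)
    (simp_all add: dc.mult vp.mult dc_schwarzian vp_schwarzian loewner_pair_def loewner_pair_ser_def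
      const_simps algebra_simps)

text \<open>The vector field changes f'(u)^2 by - 2 g^2 f'(u)^2, which cancels the term 2 g^2
  \<open>vf_series\<close> of the bracket. The rest is doubled because \<open>loewner\<close>
  contains 2 \<open>vf_point i\<close>.\<close>

lemma commutator_vf_series:
  "loewner_ser \<kappa> \<delta> i ((dz f_ser)\<^sup>2 * vf_series \<eta>) - (dz f_ser)\<^sup>2 * vf_series (loewner \<kappa> \<delta> i \<eta>)
   = (dz f_ser)\<^sup>2 * (- 2 * pole i * fls_const (vf_double_pole i \<eta>)
       - 4 * (pole i)\<^sup>2 * fls_const (vf_point i \<eta>))"
  by (subst loewner_commutator_sum)
    (simp_all add: dc.mult vp.mult dz_f_ser_sq dc_vf_series vp_vf_series loewner_pair_def loewner_pair_ser_def
      vf_series.add vf_series.mult vf_series.diff vf_series.power2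
      const_simps algebra_simps)
lemma rscalar_relation:
  assumes "\<kappa> * (2 * w + 1) = 6"
  shows "fls_const (rscalar (\<kappa> / 2)) * (4 * fls_const (rscalar w) + 2) = (6 :: 'k::{finite,linorder} alg fls)"
proof -
  have "rscalar (\<kappa> / 2) * (4 * rscalar w + 2) = (rscalar (\<kappa> / 2 * (4 * w + 2)) :: 'k alg)"
    by (simp only: of_real_add of_real_mult of_real_numeral scalar_add scalar_mult scalar_numeral)
  also have "\<kappa> / 2 * (4 * w + 2) = 6" using assms by (simp add: algebra_simps)
  finally have "fls_const (rscalar (\<kappa> / 2) * (4 * rscalar w + 2)) = (fls_const 6 :: 'k alg fls)"
    by (simp only: of_real_numeral scalar_numeral)
  then show ?thesis by (simp only: fls_const_distrib fls_const_numeral)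
qed

text \<open>At order g^4, 6 K w comes from the second derivative of w g^2, and - 8 w from the
  doubled action of the vector field on f'^2 and g^2. At order g^3 the second derivative gives K (4
  w + 2) = 6, and the doubled vector field gives - 6. The term with \<open>vf_double_pole\<close> is
  the opposite of the one that arises from \<open>vf_series\<close> once that summand is
  subtracted.\<close>

lemma commutator_pole_self:
  fixes \<delta> :: "'k::{finite,linorder} \<Rightarrow> real" and \<kappa> :: real and i :: 'k and \<eta> :: "'k alg"
  assumes "\<kappa> * (2 * \<delta> i + 1) = 6"
  defines "X \<equiv> fls_const \<eta>" and "X2 \<equiv> fls_const (d_coord i (d_coord i \<eta>))"
    and "g \<equiv> pole i" and "K \<equiv> fls_const (rscalar (\<kappa> / 2))" and "w \<equiv> \<lambda>j. fls_const (rscalar (\<delta> j))"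
    and "d \<equiv> \<lambda>l. fls_const (inv_diff l i)" and "F \<equiv> (dz f_ser :: 'k alg fls)\<^sup>2"
  shows "loewner_ser \<kappa> \<delta> i (virasoro_pole \<delta> i \<eta>) - virasoro_pole \<delta> i (loewner \<kappa> \<delta> i \<eta>) =
    F * ((6 * K - 8) * w i * g ^ 4 * X + 2 * K * g\<^sup>2 * X2
      - 2 * g * fls_const (vf_double_pole i \<eta>)
      - (\<Sum>l\<in>- {i}. g * (2 * (d l)\<^sup>2 * fls_const (d_coord l \<eta>) - 4 * w l * d l ^ 3 * X)))"
proof -
  define X1 where "X1 = fls_const (d_coord i \<eta>)"
  define k where "k = (rscalar (\<kappa> / 2) :: 'k alg)"
  have dk: "d_coord l k = 0" for l by (simp add: k_def)
  have t: "virasoro_pole \<delta> i \<zeta> = F * (w i * g\<^sup>2 * fls_const \<zeta> + g * fls_const (d_coord i \<zeta>))" for \<zeta>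
    by (simp add: virasoro_pole_def w_def g_def F_def)
  have dg: "fls_map (d_coord i) g = g\<^sup>2" "l \<noteq> i \<Longrightarrow> fls_map (d_coord l) g = 0" for l
    by (simp_all add: g_def dc_pole)
  have vg: "fls_map (vf_point i) g = - (g\<^sup>2 * g)"
    by (simp add: g_def vp_pole)
  have dw: "fls_map (d_coord l) (w j) = 0" "fls_map (vf_point i) (w j) = 0" for l j
    by (simp_all add: w_def dc_const vp_const)
  have dF: "fls_map (d_coord l) F = 0" "fls_map (vf_point i) F = - 2 * g\<^sup>2 * F" for l
    by (simp_all only: F_def g_def dz_f_ser_sq)
  have 0: "fls_const k * fls_map (d_coord i) (fls_map (d_coord i) (virasoro_pole \<delta> i \<eta>))
      - virasoro_pole \<delta> i (k * d_coord i (d_coord i \<eta>))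
    = F * (6 * K * w i * g ^ 4 * X + K * (4 * w i + 2) * g ^ 3 * X1 + 2 * K * g\<^sup>2 * X2)"
    unfolding t K_def k_def[symmetric]
    by (simp add: dc.mult dc.add dc.power2 dF dg dw dk const_simps X_def X1_def X2_def)
      (simp add: power_numeral_reduce algebra_simps)
  \<comment> \<open>The pole at x_i is constant in x_l. The terms come from d/dx_i acting on the
    coefficients 1 / (x_l - x_i) and their squares.\<close>
  have pair: "loewner_pair_ser \<delta> i l (virasoro_pole \<delta> i \<eta>) - virasoro_pole \<delta> i (loewner_pair \<delta> i l \<eta>)
    = - (F * (g * (2 * (d l)\<^sup>2 * fls_const (d_coord l \<eta>) - 4 * w l * d l ^ 3 * X)))" if "l \<in> - {i}" for l
    unfolding t loewner_pair_ser_def loewner_pair_def using that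
    by (simp add: dc.mult dc.add dc.power2 dF dg dw const_simps X_def d_coord_inv_diff d_coord.power2
        d_coord_commute[of i l] d_def w_def)
      (simp add: power_numeral_reduce algebra_simps)
  have E: "fls_map (vf_point i) (virasoro_pole \<delta> i \<eta>) - virasoro_pole \<delta> i (vf_point i \<eta>)
    = F * (- 4 * w i * g ^ 4 * X - 3 * g ^ 3 * X1 - g * fls_const (vf_double_pole i \<eta>))"
    unfolding t
    by (simp add: vp.mult vp.add vp.power2 dF dw vg const_simps X_def X1_def d_coord_vf_point)
      (simp add: power_numeral_reduce algebra_simps)
  have K: "K * (4 * w i + 2) = 6"
    unfolding K_def w_def by (rule rscalar_relation) fact
  have "virasoro_pole \<delta> i (a + b) = virasoro_pole \<delta> i a + virasoro_pole \<delta> i b" for a b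
    by (simp add: t d_coord.add fls_const_distrib algebra_simps)
  from loewner_commutator_sum[of "virasoro_pole \<delta> i", OF this, of \<kappa> \<delta> i \<eta>]
  have "loewner_ser \<kappa> \<delta> i (virasoro_pole \<delta> i \<eta>) - virasoro_pole \<delta> i (loewner \<kappa> \<delta> i \<eta>) =
      F * (6 * K * w i * g ^ 4 * X + K * (4 * w i + 2) * g ^ 3 * X1 + 2 * K * g\<^sup>2 * X2)
      + (\<Sum>l\<in>- {i}. - (F * (g * (2 * (d l)\<^sup>2 * fls_const (d_coord l \<eta>) - 4 * w l * d l ^ 3 * X))))
      + 2 * (F * (- 4 * w i * g ^ 4 * X - 3 * g ^ 3 * X1 - g * fls_const (vf_double_pole i \<eta>)))"
    unfolding 0[symmetric] E[symmetric] k_def by (simp only: pair cong: sum.cong)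
  also have "\<dots> = F * ((6 * K - 8) * w i * g ^ 4 * X + 2 * K * g\<^sup>2 * X2
      - 2 * g * fls_const (vf_double_pole i \<eta>)
      - (\<Sum>l\<in>- {i}. g * (2 * (d l)\<^sup>2 * fls_const (d_coord l \<eta>) - 4 * w l * d l ^ 3 * X)))"
    unfolding K sum_negf sum_distrib_left[symmetric] by (simp add: algebra_simps)
  finally show ?thesis .
qed

text \<open>Only the pair term of j and the vector field contribute; the second derivative in x_i
  commutes with everything attached to x_j.\<close>

lemma commutator_pole_other:
  fixes \<delta> :: "'k::{finite,linorder} \<Rightarrow> real" and \<kappa> :: real and i j :: 'k and \<eta> :: "'k alg"
  assumes ji: "j \<noteq> i"
  defines "X \<equiv> fls_const \<eta>" and "Y \<equiv> fls_const (d_coord j \<eta>)"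
    and "g \<equiv> pole i" and "G \<equiv> pole j" and "w \<equiv> \<lambda>j. fls_const (rscalar (\<delta> j))"
    and "d \<equiv> fls_const (inv_diff j i)" and "F \<equiv> (dz f_ser :: 'k alg fls)\<^sup>2"
  shows "loewner_ser \<kappa> \<delta> i (virasoro_pole \<delta> j \<eta>) - virasoro_pole \<delta> j (loewner \<kappa> \<delta> i \<eta>) =
    F * (4 * w j * d * G ^ 3 * X + (2 * d * G\<^sup>2 + 2 * G * d\<^sup>2) * Y - 4 * w j * G * d ^ 3 * X
      + 2 * (- 2 * g\<^sup>2 * (w j * G\<^sup>2 * X + G * Y) - 2 * w j * G ^ 3 * g * X - G\<^sup>2 * g * Y))"
proof -
  define k where "k = (rscalar (\<kappa> / 2) :: 'k alg)"
  have dk: "d_coord l k = 0" for l by (simp add: k_def)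
  have t: "virasoro_pole \<delta> j \<zeta> = F * (w j * G\<^sup>2 * fls_const \<zeta> + G * fls_const (d_coord j \<zeta>))" for \<zeta>
    by (simp add: virasoro_pole_def w_def G_def F_def)
  have dG: "fls_map (d_coord j) G = G\<^sup>2" "l \<noteq> j \<Longrightarrow> fls_map (d_coord l) G = 0" for l
    by (simp_all add: G_def dc_pole)
  have vG: "fls_map (vf_point i) G = - (G\<^sup>2 * g)"
    by (simp add: G_def g_def vp_pole)
  have dw: "fls_map (d_coord l) (w j) = 0" "fls_map (vf_point i) (w j) = 0" for l j
    by (simp_all add: w_def dc_const vp_const)
  have dF: "fls_map (d_coord l) F = 0" "fls_map (vf_point i) F = - 2 * g\<^sup>2 * F" for l
    by (simp_all only: F_def g_def dz_f_ser_sq)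
  have 0: "fls_const k * fls_map (d_coord i) (fls_map (d_coord i) (virasoro_pole \<delta> j \<eta>))
      - virasoro_pole \<delta> j (k * d_coord i (d_coord i \<eta>)) = 0"
    unfolding t using ji
    by (simp add: dc.mult dc.add dc.power2 dF dG dw dk const_simps d_coord_commute[of i j] algebra_simps)
  \<comment> \<open>For l \<noteq> j the pair term and the pole term share no coordinate in which
    one differentiates and the other has a coefficient, so they commute.\<close>
  have pair: "loewner_pair_ser \<delta> i l (virasoro_pole \<delta> j \<eta>) - virasoro_pole \<delta> j (loewner_pair \<delta> i l \<eta>)
    = (if l = j then F * (4 * w j * d * G ^ 3 * X + (2 * d * G\<^sup>2 + 2 * G * d\<^sup>2) * Y - 4 * w j * G * d ^ 3 * X) else 0)"
    if "l \<in> - {i}" for l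
  proof (cases "l = j")
    case True
    then show ?thesis
      unfolding t loewner_pair_ser_def loewner_pair_def using ji
      by (simp add: dc.mult dc.add dc.power2 dF dG dw const_simps X_def Y_def d_coord_inv_diff d_coord.power2
          d_def w_def)
        (simp add: power_numeral_reduce algebra_simps)
  next
    case False
    then show ?thesis
      unfolding t loewner_pair_ser_def loewner_pair_def using ji that
      by (simp add: dc.mult dc.add dc.power2 dF dG dw const_simps X_def d_coord_inv_diff d_coord.power2
          d_coord_commute[of j l])
        (simp add: algebra_simps)
  qed
  have E: "fls_map (vf_point i) (virasoro_pole \<delta> j \<eta>) - virasoro_pole \<delta> j (vf_point i \<eta>)
    = F * (- 2 * g\<^sup>2 * (w j * G\<^sup>2 * X + G * Y) - 2 * w j * G ^ 3 * g * X - G\<^sup>2 * g * Y)"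
    unfolding t using ji
    by (simp add: vp.mult vp.add vp.power2 dF dw vG const_simps X_def Y_def d_coord_vf_point)
      (simp add: power_numeral_reduce algebra_simps)
  have "virasoro_pole \<delta> j (a + b) = virasoro_pole \<delta> j a + virasoro_pole \<delta> j b" for a b
    by (simp add: t d_coord.add fls_const_distrib algebra_simps)
  from loewner_commutator_sum[of "virasoro_pole \<delta> j", OF this, of \<kappa> \<delta> i \<eta>]
  have "loewner_ser \<kappa> \<delta> i (virasoro_pole \<delta> j \<eta>) - virasoro_pole \<delta> j (loewner \<kappa> \<delta> i \<eta>) =
    F * (4 * w j * d * G ^ 3 * X + (2 * d * G\<^sup>2 + 2 * G * d\<^sup>2) * Y - 4 * w j * G * d ^ 3 * X)
    + 2 * (F * (- 2 * g\<^sup>2 * (w j * G\<^sup>2 * X + G * Y) - 2 * w j * G ^ 3 * g * X - G\<^sup>2 * g * Y))"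
    using ji unfolding 0[unfolded k_def] E by (simp add: pair)
  then show ?thesis
    by (simp only: distrib_left mult.left_commute)
qed

text \<open>
  Partial fractions: \<open>1 / (f - x\<^sub>i)\<close>, \<open>1 / (f - x\<^sub>j)\<close> and \<open>1 / (x\<^sub>j - x\<^sub>i)\<close> are the inverses of
  three elements the first of which is the sum of the other two.
\<close>

lemma pole_partial_fraction:
  assumes "j \<noteq> i"
  shows "pole j * fls_const (inv_diff j i) = pole i * (pole j + fls_const (inv_diff j i))"
proof -
  let ?d = "fls_const (inv_diff j i)" and ?c = "\<lambda>j. fls_const (coord j) :: 'a alg fls"
  have d: "(?c j - ?c i) * ?d = 1"
    using arg_cong[OF inv_diff[OF assms], of fls_const] by (simp add: fls_const_distrib)
  have "pole j * ?d = ((f_ser - ?c i) * pole i) * (pole j * ?d)"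
    by (simp add: pole)
  also have "\<dots> = pole i * (((f_ser - ?c j) * pole j) * ?d + ((?c j - ?c i) * ?d) * pole j)"
    by (simp add: algebra_simps)
  finally show ?thesis unfolding pole d by (simp add: algebra_simps)
qed

text \<open>The left side joins the commutator of the pole at x_j with the summand number j left
  over from the pole at x_i; the right side is the pair term of 2 g^2 \<open>loewner\<close>. Their
  difference is an explicit multiple of \<open>?e\<close>, which vanishes by assumption.\<close>

lemma partial_fraction_cancel:
  fixes d G g w X Y :: "'a::comm_ring_1"
  assumes "G * d = g * (G + d)"
  shows "4 * w * d * G ^ 3 * X + (2 * d * G\<^sup>2 + 2 * G * d\<^sup>2) * Y - 4 * w * G * d ^ 3 * X
      + 2 * (- 2 * g\<^sup>2 * (w * G\<^sup>2 * X + G * Y) - 2 * w * G ^ 3 * g * X - G\<^sup>2 * g * Y)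
      - g * (2 * d\<^sup>2 * Y - 4 * w * d ^ 3 * X)
    = 2 * g\<^sup>2 * (2 * d * Y - 2 * w * d\<^sup>2 * X)"
proof -
  let ?e = "G * d - g * (G + d)"
  have "4 * w * d * G ^ 3 * X + (2 * d * G\<^sup>2 + 2 * G * d\<^sup>2) * Y - 4 * w * G * d ^ 3 * X
      + 2 * (- 2 * g\<^sup>2 * (w * G\<^sup>2 * X + G * Y) - 2 * w * G ^ 3 * g * X - G\<^sup>2 * g * Y)
      - g * (2 * d\<^sup>2 * Y - 4 * w * d ^ 3 * X) - 2 * g\<^sup>2 * (2 * d * Y - 2 * w * d\<^sup>2 * X)
    = ?e * (4 * w * X * (G\<^sup>2 - d\<^sup>2) + 4 * w * X * g * (G - d) + 2 * Y * (G + d) + 4 * Y * g)"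
    by (simp add: power_numeral_reduce algebra_simps)
  then show ?thesis using assms by simp
qed

text \<open>The order of the operators is A L - L A, hence the positive sign.\<close>

theorem loewner_virasoro_commutator:
  fixes \<delta> :: "'k::{finite,linorder} \<Rightarrow> real"
  assumes \<delta>: "\<kappa> * (2 * \<delta> i + 1) = 6" and c: "c = (3 * \<kappa> - 8) * \<delta> i"
  shows "loewner_ser \<kappa> \<delta> i (virasoro c \<delta> \<eta>) - virasoro c \<delta> (loewner \<kappa> \<delta> i \<eta>)
    = 2 * (dz f_ser)\<^sup>2 * (pole i)\<^sup>2 * fls_const (loewner \<kappa> \<delta> i \<eta>)"
proof -
  let ?F = "(dz f_ser :: 'k alg fls)\<^sup>2" and ?C = "fls_const :: 'k alg \<Rightarrow> 'k alg fls"
  let ?K = "?C (rscalar (\<kappa> / 2))" and ?w = "\<lambda>j. ?C (rscalar (\<delta> j))" and ?d = "\<lambda>j. ?C (inv_diff j i)"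
  let ?S = "\<lambda>\<zeta>. ?C (rscalar (c / 12)) * schwarzian f_ser * ?C \<zeta>"
  let ?com = "\<lambda>t. loewner_ser \<kappa> \<delta> i (t \<eta>) - t (loewner \<kappa> \<delta> i \<eta>)"
  have add: "loewner_ser \<kappa> \<delta> i (Y + Z) = loewner_ser \<kappa> \<delta> i Y + loewner_ser \<kappa> \<delta> i Z" for Y Z
    by (simp add: loewner_ser_def loewner_pair_ser_def dc.add vp.add algebra_simps sum.distrib sum_subtractf)
  have minus: "loewner_ser \<kappa> \<delta> i (Y - Z) = loewner_ser \<kappa> \<delta> i Y - loewner_ser \<kappa> \<delta> i Z" for Y Z
    using add[of "Y - Z" Z] by simp
  have "loewner_ser \<kappa> \<delta> i 0 = 0" using add[of 0 0] by simp
  then have sum: "loewner_ser \<kappa> \<delta> i (sum Y I) = (\<Sum>j\<in>I. loewner_ser \<kappa> \<delta> i (Y j))" for Y and I :: "'k set"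
    by (induction I rule: infinite_finite_induct) (simp_all add: add)
  have UNIV: "(UNIV :: 'k set) = insert i (- {i})" by auto
  have "?com (virasoro c \<delta>) = ?com ?S - ?com (\<lambda>\<zeta>. ?F * vf_series \<zeta>)
      + (?com (virasoro_pole \<delta> i) + (\<Sum>j\<in>- {i}. ?com (virasoro_pole \<delta> j)))"
    unfolding virasoro_def add minus sum UNIV by (simp add: sum_subtractf)
  \<comment> \<open>The two \<open>vf_double_pole\<close> terms have cancelled, and the sum over j
    left over from the pole at x_i is merged with the other poles.\<close>
  also have "\<dots> = ?F * ((6 * ?K - 8) * ?w i - 12 * ?C (rscalar (c / 12))) * pole i ^ 4 * ?C \<eta>
      + ?F * (2 * ?K * (pole i)\<^sup>2 * ?C (d_coord i (d_coord i \<eta>)) + 4 * (pole i)\<^sup>2 * ?C (vf_point i \<eta>))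
      + ?F * (\<Sum>j\<in>- {i}. 4 * ?w j * ?d j * pole j ^ 3 * ?C \<eta>
          + (2 * ?d j * (pole j)\<^sup>2 + 2 * pole j * (?d j)\<^sup>2) * ?C (d_coord j \<eta>)
          - 4 * ?w j * pole j * (?d j) ^ 3 * ?C \<eta>
          + 2 * (- 2 * (pole i)\<^sup>2 * (?w j * (pole j)\<^sup>2 * ?C \<eta> + pole j * ?C (d_coord j \<eta>))
              - 2 * ?w j * pole j ^ 3 * pole i * ?C \<eta> - (pole j)\<^sup>2 * pole i * ?C (d_coord j \<eta>))
          - pole i * (2 * (?d j)\<^sup>2 * ?C (d_coord j \<eta>) - 4 * ?w j * ?d j ^ 3 * ?C \<eta>))"
    unfolding commutator_schwarzian commutator_vf_series commutator_pole_self[where \<kappa> = \<kappa> and \<delta> = \<delta> and i = i, OF \<delta>]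
    by (simp add: commutator_pole_other sum_subtractf sum.distrib flip: sum_distrib_left)
      (simp add: algebra_simps)
  \<comment> \<open>With K = \<kappa>/2 this is (3 \<kappa> - 8) \<delta>_i - c: the pole at x_i
    against the Schwarzian.\<close>
  also have "(6 * ?K - 8) * ?w i - 12 * ?C (rscalar (c / 12)) = 0"
  proof -
    have "(6 * ?K - 8) * ?w i - 12 * ?C (rscalar (c / 12))
        = ?C (rscalar ((6 * (\<kappa> / 2) - 8) * \<delta> i - 12 * (c / 12)))"
      by (simp only: of_real_diff of_real_mult of_real_numeral scalar_diff scalar_mult scalar_numeral
          fls_const_distrib fls_const_numeral)
    also have "(6 * (\<kappa> / 2) - 8) * \<delta> i - 12 * (c / 12) = 0"
      by (simp add: c)
    finally show ?thesis by simp
  qed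
  also have "(\<Sum>j\<in>- {i}. 4 * ?w j * ?d j * pole j ^ 3 * ?C \<eta>
          + (2 * ?d j * (pole j)\<^sup>2 + 2 * pole j * (?d j)\<^sup>2) * ?C (d_coord j \<eta>)
          - 4 * ?w j * pole j * (?d j) ^ 3 * ?C \<eta>
          + 2 * (- 2 * (pole i)\<^sup>2 * (?w j * (pole j)\<^sup>2 * ?C \<eta> + pole j * ?C (d_coord j \<eta>))
              - 2 * ?w j * pole j ^ 3 * pole i * ?C \<eta> - (pole j)\<^sup>2 * pole i * ?C (d_coord j \<eta>))
          - pole i * (2 * (?d j)\<^sup>2 * ?C (d_coord j \<eta>) - 4 * ?w j * ?d j ^ 3 * ?C \<eta>))
      = (\<Sum>j\<in>- {i}. 2 * (pole i)\<^sup>2 * (2 * ?d j * ?C (d_coord j \<eta>) - 2 * ?w j * (?d j)\<^sup>2 * ?C \<eta>))"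
    by (intro sum.cong refl partial_fraction_cancel pole_partial_fraction) simp
  also have "?F * 0 * pole i ^ 4 * ?C \<eta>
      + ?F * (2 * ?K * (pole i)\<^sup>2 * ?C (d_coord i (d_coord i \<eta>)) + 4 * (pole i)\<^sup>2 * ?C (vf_point i \<eta>))
      + ?F * (\<Sum>j\<in>- {i}. 2 * (pole i)\<^sup>2 * (2 * ?d j * ?C (d_coord j \<eta>) - 2 * ?w j * (?d j)\<^sup>2 * ?C \<eta>))
    = 2 * ?F * (pole i)\<^sup>2 * ?C (loewner \<kappa> \<delta> i \<eta>)"
    unfolding loewner_def loewner_pair_def sum_distrib_left[symmetric]
    by (simp add: fls_const_distrib fls_const_sum) (simp add: algebra_simps)
  finally show ?thesis .
qed

section \<open>Homogeneity\<close>

definition qmonom :: "'k \<Rightarrow> (qvar \<Rightarrow>\<^sub>0 nat) \<Rightarrow> 'k::{finite,linorder} alg" where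
  "qmonom i \<mu> = (\<Prod>v\<in>Poly_Mapping.keys \<mu>. qvar_value i v ^ Poly_Mapping.lookup \<mu> v)"

definition qweight :: "(qvar \<Rightarrow>\<^sub>0 nat) \<Rightarrow> int" where
  "qweight \<mu> = (\<Sum>v\<in>Poly_Mapping.keys \<mu>. int (Poly_Mapping.lookup \<mu> v) * qvar_degree v)"

lemma qmonom_add: "qmonom i (\<mu> + \<nu>) = qmonom i \<mu> * qmonom i \<nu>"
proof -
  let ?V = "Poly_Mapping.keys \<mu> \<union> Poly_Mapping.keys \<nu>"
  have "qmonom i \<rho> = (\<Prod>v\<in>?V. qvar_value i v ^ Poly_Mapping.lookup \<rho> v)"
    if "Poly_Mapping.keys \<rho> \<subseteq> ?V" for \<rho>
    unfolding qmonom_def using that by (intro prod.mono_neutral_left) (auto simp: in_keys_iff)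
  then show ?thesis
    using keys_add[of \<mu> \<nu>] by (simp add: lookup_add power_add prod.distrib)
qed

lemma qweight_add: "qweight (\<mu> + \<nu>) = qweight \<mu> + qweight \<nu>"
proof -
  let ?V = "Poly_Mapping.keys \<mu> \<union> Poly_Mapping.keys \<nu>"
  have "qweight \<rho> = (\<Sum>v\<in>?V. int (Poly_Mapping.lookup \<rho> v) * qvar_degree v)"
    if "Poly_Mapping.keys \<rho> \<subseteq> ?V" for \<rho>
    unfolding qweight_def using that by (intro sum.mono_neutral_left) (auto simp: in_keys_iff)
  then show ?thesis
    using keys_add[of \<mu> \<nu>] by (simp add: lookup_add distrib_right sum.distrib)
qed

lemma homogeneous_iff: "homogeneous d q \<longleftrightarrow> (\<forall>\<mu>\<in>Poly_Mapping.keys q. qweight \<mu> = d)"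
  by (simp add: homogeneous_def qweight_def)

lemma q_value_eq_sum:
  assumes "finite M" "Poly_Mapping.keys q \<subseteq> M"
  shows "q_value q i = (\<Sum>\<mu>\<in>M. scalar (Poly_Mapping.lookup q \<mu>) * qmonom i \<mu>)"
  unfolding q_value_def qmonom_def using assms
  by (intro sum.mono_neutral_left) (auto simp: in_keys_iff)

lemma q_value_0 [simp]: "q_value 0 i = 0"
  by (simp add: q_value_def)

lemma q_value_add: "q_value (p + q) i = q_value p i + q_value q i"
proof -
  let ?M = "Poly_Mapping.keys p \<union> Poly_Mapping.keys q"
  have "q_value r i = (\<Sum>\<mu>\<in>?M. scalar (Poly_Mapping.lookup r \<mu>) * qmonom i \<mu>)"
    if "Poly_Mapping.keys r \<subseteq> ?M" for r
    using that by (intro q_value_eq_sum) auto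
  then show ?thesis
    using keys_add[of p q] by (simp add: lookup_add scalar_add distrib_right sum.distrib)
qed

lemma q_value_single: "q_value (Poly_Mapping.single \<mu> a) i = scalar a * qmonom i \<mu>"
  by (subst q_value_eq_sum[of "{\<mu>}"]) auto

lemma q_value_mult: "q_value (p * q) i = q_value p i * q_value q i"
proof (induction p rule: poly_mapping_single_induct)
  case (3 \<mu> a)
  show ?case
    by (induction q rule: poly_mapping_single_induct)
      (simp_all add: q_value_add q_value_single mult_single scalar_mult qmonom_add algebra_simps)
qed (simp_all add: q_value_add algebra_simps)

text \<open>The polynomial is chosen before i: one q has to serve all coordinates, so homogeneity is
  a property of the family r.\<close>

definition homogeneous_value :: "int \<Rightarrow> ('k::{finite,linorder} \<Rightarrow> 'k alg) \<Rightarrow> bool" where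
  "homogeneous_value d r \<longleftrightarrow> (\<exists>q. homogeneous d q \<and> (\<forall>i. q_value q i = r i))"

lemma homogeneous_value_0: "homogeneous_value d (\<lambda>_. 0)"
  unfolding homogeneous_value_def by (rule exI[of _ 0]) (simp add: homogeneous_def)

lemma homogeneous_value_add:
  assumes "homogeneous_value d r" "homogeneous_value d s"
  shows "homogeneous_value d (\<lambda>i. r i + s i)"
proof -
  from assms obtain p q where "homogeneous d p" "\<And>i. q_value p i = r i"
    "homogeneous d q" "\<And>i. q_value q i = s i"
    unfolding homogeneous_value_def by blast
  then show ?thesis
    unfolding homogeneous_value_def homogeneous_iff using keys_add[of p q]
    by (intro exI[of _ "p + q"]) (auto simp: q_value_add)
qed

lemma homogeneous_value_mult:
  assumes "homogeneous_value d r" "homogeneous_value e s"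
  shows "homogeneous_value (d + e) (\<lambda>i. r i * s i)"
proof -
  from assms obtain p q where "homogeneous d p" "\<And>i. q_value p i = r i"
    "homogeneous e q" "\<And>i. q_value q i = s i"
    unfolding homogeneous_value_def by blast
  then show ?thesis
    unfolding homogeneous_value_def homogeneous_iff using keys_mult[of p q]
    by (intro exI[of _ "p * q"]) (fastforce simp: q_value_mult qweight_add)
qed

lemma homogeneous_value_sum:
  "(\<And>j. j \<in> I \<Longrightarrow> homogeneous_value d (r j)) \<Longrightarrow> homogeneous_value d (\<lambda>i. \<Sum>j\<in>I. r j i)"
  by (induction I rule: infinite_finite_induct) (auto intro: homogeneous_value_0 homogeneous_value_add)

lemma homogeneous_value_scalar: "homogeneous_value 0 (\<lambda>_. scalar a)"
  unfolding homogeneous_value_def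
  by (rule exI[of _ "Poly_Mapping.single 0 a"])
    (auto simp: homogeneous_iff q_value_single qweight_def qmonom_def split: if_splits)

lemma homogeneous_value_1: "homogeneous_value 0 (\<lambda>_. 1)"
  using homogeneous_value_scalar[of 1] by simp

lemma homogeneous_value_qvar: "homogeneous_value (qvar_degree v) (\<lambda>i. qvar_value i v)"
  unfolding homogeneous_value_def
  by (rule exI[of _ "Poly_Mapping.single (Poly_Mapping.single v 1) 1"])
    (auto simp: homogeneous_iff q_value_single qweight_def qmonom_def)

lemma homogeneous_value_of_int_mult:
  assumes "homogeneous_value d r"
  shows "homogeneous_value d (\<lambda>i. of_int n * r i)"
proof -
  have "scalar (of_int n) = (of_int n :: 'a alg)"
    by (rule comm_ring_hom.hom_of_int) (unfold_locales, simp_all add: scalar_add scalar_mult)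
  then show ?thesis
    using homogeneous_value_mult[OF homogeneous_value_scalar[of "of_int n"] assms] by simp
qed

lemma homogeneous_value_diff:
  assumes "homogeneous_value d r" "homogeneous_value d s"
  shows "homogeneous_value d (\<lambda>i. r i - s i)"
  using homogeneous_value_add[OF assms(1) homogeneous_value_of_int_mult[OF assms(2), of "- 1"]] by simp

text \<open>The coefficient number \<open>n\<close> belongs to \<open>z\<^bsup>-n\<^esup>\<close>, and \<open>z\<close> has degree \<open>1\<close>.\<close>

definition homogeneous_series :: "int \<Rightarrow> ('k::{finite,linorder} \<Rightarrow> 'k alg fls) \<Rightarrow> bool" where
  "homogeneous_series d Y \<longleftrightarrow> (\<forall>n. homogeneous_value (d + n) (\<lambda>i. fls_nth (Y i) n))"

text \<open>The bounds a and b are uniform in i, so a coefficient of the product is a finite sum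
  over indices independent of i.\<close>

lemma homogeneous_series_mult:
  assumes "homogeneous_series d Y" "homogeneous_series e Z"
    and "\<And>i n. n < a \<Longrightarrow> fls_nth (Y i) n = 0" "\<And>i n. n < b \<Longrightarrow> fls_nth (Z i) n = 0"
  shows "homogeneous_series (d + e) (\<lambda>i. Y i * Z i)"
  unfolding homogeneous_series_def
proof
  fix n
  have "homogeneous_value (d + e + n) (\<lambda>i. fls_nth (Y i) k * fls_nth (Z i) (n - k))" for k
    using assms(1,2) homogeneous_value_mult[of "d + k" _ "e + (n - k)"]
    unfolding homogeneous_series_def by (fastforce simp: algebra_simps)
  then show "homogeneous_value (d + e + n) (\<lambda>i. fls_nth (Y i * Z i) n)"
    using assms(3,4) by (simp add: fls_times_nth_bounds[where a = a and b = b] homogeneous_value_sum)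
qed

text \<open>For n \<ge> 1 the coefficient number n is the indeterminate number n - 1, whose degree
  is (n - 1) + 2 = 1 + n.\<close>

lemma homogeneous_series_f_ser: "homogeneous_series 1 (\<lambda>_. f_ser)"
proof -
  have "homogeneous_value (1 + n) (\<lambda>_. fvar (nat n - 1))" if "n \<ge> 1" for n
    using homogeneous_value_qvar[of "F_var (nat n - 1)"] that by (simp add: nat_diff_distrib)
  then show ?thesis
    by (auto simp: homogeneous_series_def f_ser_def fseries_nth intro: homogeneous_value_0 homogeneous_value_1)
qed

lemma homogeneous_series_dz_f_ser: "homogeneous_series 0 (\<lambda>_. dz f_ser)"
  unfolding homogeneous_series_def dz_nth
proof (intro allI homogeneous_value_of_int_mult)
  fix n
  show "homogeneous_value (0 + n) (\<lambda>_. fls_nth f_ser (n - 1))"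
    using homogeneous_series_f_ser[unfolded homogeneous_series_def, rule_format, of "n - 1"] by simp
qed

lemma pole_nth_eq_0: "n < 1 \<Longrightarrow> fls_nth (pole i) n = 0"
  by (simp add: pole_def expansion_nth_eq_0)

text \<open>Since f - x has leading term z with coefficient 1, the equation (f - x) g = 1 can be
  solved recursively: its coefficient number n gives the coefficient n + 1 of g from earlier ones by
  ring operations that respect degrees.\<close>

lemma homogeneous_series_pole: "homogeneous_series (- 1) (pole :: 'k::{finite,linorder} \<Rightarrow> 'k alg fls)"
proof -
  let ?h = "\<lambda>i :: 'k. f_ser - fls_const (coord i)"
  have h: "homogeneous_value (1 + n) (\<lambda>i. fls_nth (?h i) n)" for n
  proof -
    have "homogeneous_value (1 + n) (\<lambda>i :: 'k. fls_nth (fls_const (coord i)) n)"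
      using homogeneous_value_qvar[of X_var] homogeneous_value_0 by (cases "n = 0") simp_all
    then show ?thesis
      unfolding fls_minus_nth
      by (intro homogeneous_value_diff homogeneous_series_f_ser[unfolded homogeneous_series_def, rule_format])
  qed
  have h0: "fls_nth (?h i) n = 0" if "n < - 1" for i and n
    using that by (simp add: f_ser_def fseries_nth)
  have rec: "fls_nth (pole i) (n + 1) = fls_nth 1 n - (\<Sum>k=0..n - 1. fls_nth (?h i) k * fls_nth (pole i) (n - k))"
    if "n \<ge> 0" for i n
  proof -
    have "fls_nth (?h i * pole i) n = (\<Sum>k=-1..n - 1. fls_nth (?h i) k * fls_nth (pole i) (n - k))"
      by (rule fls_times_nth_bounds) (fact h0 pole_nth_eq_0)+
    also have "{-1..n - 1} = insert (- 1) {0..n - 1}" using that by auto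
    also have "(\<Sum>k\<in>\<dots>. fls_nth (?h i) k * fls_nth (pole i) (n - k))
        = fls_nth (pole i) (n + 1) + (\<Sum>k=0..n - 1. fls_nth (?h i) k * fls_nth (pole i) (n - k))"
      by (simp add: f_ser_def fseries_nth)
    finally show ?thesis unfolding pole by (simp add: algebra_simps)
  qed
  have "homogeneous_value (- 1 + int m) (\<lambda>i :: 'k. fls_nth (pole i) (int m))" for m
  proof (induction m rule: less_induct)
    case (less m)
    show ?case
    proof (cases m)
      case 0
      then show ?thesis by (simp add: pole_nth_eq_0 homogeneous_value_0)
    next
      case (Suc n)
      have "homogeneous_value (int n) (\<lambda>i. fls_nth (?h i) k * fls_nth (pole i) (int n - k))"
        if "k \<in> {0..int n - 1}" for k
      proof -
        have "nat (int n - k) < m" using that Suc by auto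
        from homogeneous_value_mult[OF h[of k] less[OF this]] show ?thesis using that by simp
      qed
      moreover have "homogeneous_value (int n) (\<lambda>i :: 'k. fls_nth 1 (int n))"
        using homogeneous_value_1 homogeneous_value_0 by (cases "n = 0") auto
      ultimately have "homogeneous_value (int n) (\<lambda>i :: 'k. fls_nth 1 (int n)
          - (\<Sum>k=0..int n - 1. fls_nth (?h i) k * fls_nth (pole i) (int n - k)))"
        by (intro homogeneous_value_diff homogeneous_value_sum)
      moreover have "int m = int n + 1" using Suc by simp
      ultimately show ?thesis by (simp only: rec of_nat_0_le_iff) simp
    qed
  qed
  then have "homogeneous_value (- 1 + n) (\<lambda>i :: 'k. fls_nth (pole i) n)" for n
    by (cases "n \<ge> 0") (metis int_nat_eq, simp add: pole_nth_eq_0 homogeneous_value_0)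
  then show ?thesis by (simp add: homogeneous_series_def)
qed

lemma dz_f_ser_nth_eq_0: "n < 0 \<Longrightarrow> fls_nth (dz f_ser) n = 0"
  by (simp add: dz_nth f_ser_def fseries_nth)

lemma dz_f_ser_sq_nth_eq_0: "n < 0 \<Longrightarrow> fls_nth ((dz f_ser)\<^sup>2) n = 0"
  unfolding power2_eq_square
  by (subst fls_times_nth_bounds[where a = 0 and b = 0]) (simp_all add: dz_f_ser_nth_eq_0)

lemma pole_sq_nth_eq_0: "n < 2 \<Longrightarrow> fls_nth ((pole i)\<^sup>2) n = 0"
  unfolding power2_eq_square
  by (subst fls_times_nth_bounds[where a = 1 and b = 1]) (simp_all add: pole_nth_eq_0)

text \<open>The series starts at u^(-2), so its coefficient number 2 - n vanishes for n > 0.\<close>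

lemma commutator_coeff_eq_0: "n < 2 \<Longrightarrow> fls_nth ((dz f_ser)\<^sup>2 * (pole i)\<^sup>2) n = 0"
  by (subst fls_times_nth_bounds[where a = 0 and b = 2])
    (simp_all add: dz_f_ser_sq_nth_eq_0 pole_sq_nth_eq_0)

lemma homogeneous_commutator_coeff:
  "homogeneous_value (- n) (\<lambda>i :: 'k::{finite,linorder}. fls_nth (- (2 * (dz f_ser)\<^sup>2 * (pole i)\<^sup>2)) (2 - n))"
proof -
  have F: "homogeneous_series 0 (\<lambda>_ :: 'k. (dz f_ser)\<^sup>2)"
    using homogeneous_series_mult[OF homogeneous_series_dz_f_ser homogeneous_series_dz_f_ser, of 0 0]
    by (simp add: dz_f_ser_nth_eq_0 power2_eq_square)
  have p: "homogeneous_series (- 2) (\<lambda>i :: 'k. (pole i)\<^sup>2)"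
    using homogeneous_series_mult[OF homogeneous_series_pole homogeneous_series_pole, of 1 1]
    by (simp add: pole_nth_eq_0 power2_eq_square)
  have "homogeneous_series (- 2) (\<lambda>i :: 'k. (dz f_ser)\<^sup>2 * (pole i)\<^sup>2)"
    using homogeneous_series_mult[OF F p, of 0 2] by (simp add: dz_f_ser_sq_nth_eq_0 pole_sq_nth_eq_0)
  then have "homogeneous_value (- 2 + (2 - n)) (\<lambda>i :: 'k. fls_nth ((dz f_ser)\<^sup>2 * (pole i)\<^sup>2) (2 - n))"
    unfolding homogeneous_series_def by blast
  from homogeneous_value_of_int_mult[OF this, of "- 2"] show ?thesis
    by (simp add: mult.assoc)
qed

theorem corollary4p5:
  fixes \<kappa> :: real
    and X :: "'k::{finite,linorder} set"
    and \<kappa>' h \<delta> :: "'k \<Rightarrow> real"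
    and c :: real
  assumes "\<kappa> > 0"
    and "X \<noteq> {}"
    and "\<And>i. i \<in> X \<Longrightarrow> \<kappa>' i \<in> {\<kappa>, 16 / \<kappa>}"
    and "\<And>i. i \<in> X \<Longrightarrow> \<delta> i = (6 - \<kappa>' i) / (2 * \<kappa>' i)"
    and "\<And>i. i \<notin> X \<Longrightarrow> \<delta> i = h i"
    and "c = (6 - \<kappa>) * (3 * \<kappa> - 8) / (2 * \<kappa>)"
  shows "(\<exists>q :: int \<Rightarrow> (qvar, complex) mvpoly.
           (\<forall>n. homogeneous (- n) (q n) \<and> (q n \<noteq> 0 \<longrightarrow> n \<le> 0)) \<and>
           (\<forall>n. \<forall>i\<in>X. \<forall>\<eta> :: 'k alg.
              L_op c \<delta> n (A_op X \<kappa>' h i \<eta>) - A_op X \<kappa>' h i (L_op c \<delta> n \<eta>)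
                = q_value (q n) i * A_op X \<kappa>' h i \<eta>)) \<and>
         (\<forall>n. \<forall>i\<in>X. \<forall>\<eta> :: 'k alg.
           A_op X \<kappa>' h i \<eta> = 0 \<longrightarrow> A_op X \<kappa>' h i (L_op c \<delta> n \<eta>) = 0)"
proof -
  let ?r = "\<lambda>n i. fls_nth (- (2 * (dz f_ser)\<^sup>2 * (pole i)\<^sup>2)) (2 - n) :: 'k alg"
  have \<kappa>'_ne: "\<kappa>' j \<noteq> 0" if "j \<in> X" for j
    using assms(1) assms(3)[OF that] by auto
  have \<kappa>': "\<kappa>' j * (2 * \<delta> j + 1) = 6" "c = (3 * \<kappa>' j - 8) * \<delta> j" if j: "j \<in> X" for j
  proof -
    show "\<kappa>' j * (2 * \<delta> j + 1) = 6"
      using \<kappa>'_ne[OF j] unfolding assms(4)[OF j] by (simp add: field_simps)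
    consider "\<kappa>' j = \<kappa>" | "\<kappa>' j = 16 / \<kappa>" using assms(3)[OF j] by blast
    then show "c = (3 * \<kappa>' j - 8) * \<delta> j"
    proof cases
      case 1
      show ?thesis unfolding assms(4)[OF j] assms(6) 1 using assms(1) by (simp add: field_simps)
    next
      \<comment> \<open>At 16/\<kappa> the factors 3 t - 8 and 6 - t become 8 (6 - \<kappa>) /
        \<kappa> and 2 (3 \<kappa> - 8) / \<kappa>: they are exchanged up to factors absorbed by the
        denominator.\<close>
      case 2
      show ?thesis unfolding assms(4)[OF j] assms(6) 2 using assms(1) by (simp add: field_simps)
    qed
  qed
  have A: "A_op X \<kappa>' h i \<eta> = loewner (\<kappa>' i) \<delta> i \<eta>" if "i \<in> X" for i \<eta>
    using that \<kappa>'_ne assms(4,5) by (intro A_op_loewner)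
  have com: "L_op c \<delta> n (A_op X \<kappa>' h i \<eta>) - A_op X \<kappa>' h i (L_op c \<delta> n \<eta>) = ?r n i * A_op X \<kappa>' h i \<eta>"
    if i: "i \<in> X" for n i \<eta>
  proof -
    let ?A = "loewner (\<kappa>' i) \<delta> i"
    have "virasoro c \<delta> (?A \<eta>) - loewner_ser (\<kappa>' i) \<delta> i (virasoro c \<delta> \<eta>)
        = - (2 * (dz f_ser)\<^sup>2 * (pole i)\<^sup>2) * fls_const (?A \<eta>)"
      using loewner_virasoro_commutator[of "\<kappa>' i" \<delta> i c \<eta>, OF \<kappa>'[OF i]] by (simp add: algebra_simps)
    from arg_cong[OF this, of "\<lambda>Y. fls_nth Y (2 - n)"] show ?thesis
      unfolding A[OF i] L_op_virasoro by (simp add: loewner_ser_nth)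
  qed
  have "\<exists>q. homogeneous (- n) q \<and> (q \<noteq> 0 \<longrightarrow> n \<le> 0) \<and> (\<forall>i. q_value q i = ?r n i)" for n
  proof (cases "n \<le> 0")
    case True
    then show ?thesis
      using homogeneous_commutator_coeff[of n] unfolding homogeneous_value_def by blast
  next
    case False
    then have "?r n i = 0" for i
      using commutator_coeff_eq_0[of "2 - n" i] by (simp add: mult.assoc)
    \<comment> \<open>For n > 0 the zero polynomial is chosen, so that q n itself and not only its
      value is 0.\<close>
    then show ?thesis
      by (intro exI[of _ 0]) (simp add: homogeneous_def)
  qed
  then obtain q where q: "\<And>n. homogeneous (- n) (q n) \<and> (q n \<noteq> 0 \<longrightarrow> n \<le> 0)"
    "\<And>n i. q_value (q n) i = ?r n i" by metis
  \<comment> \<open>If A \<eta> = 0, the commutator relation reduces to A (L \<eta>) = L 0.\<close>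
  have "L_op c \<delta> n 0 = 0" for n
    by (simp add: L_op_virasoro virasoro_def virasoro_pole_def)
  then have "A_op X \<kappa>' h i (L_op c \<delta> n \<eta>) = 0" if "i \<in> X" "A_op X \<kappa>' h i \<eta> = 0" for i n \<eta>
    using com[OF that(1), of n \<eta>] that(2) by simp
  then show ?thesis
    using q com by (intro conjI exI[of _ q]) auto
qed

end
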